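(* Let $\chi$ be any non-principal Dirichlet character to the prime modulus $p$, and let $N$ and $H$ be integers with $H\ge 1$ such that $\chi$ is constant on $(N,N+H]$. Then $$H<\left\{\frac{\pi e\sqrt{6}}{3}+o(1)\right\}p^{1/4}\log p ,$$ where $o(1)$ denotes a function of $p$ alone that tends to $0$ as $p\to\infty$. That is: there is a function $\varepsilon$ on the primes with $\varepsilon(p)\to 0$ as $p\to\infty$ such that, for every prime $p$, every non-principal Dirichlet character $\chi$ modulo $p$, and all integers $N$ and $H\ge1$ for which $\chi$ is constant on $(N,N+H]$, one has $H<\left(\frac{\pi e\sqrt6}{3}+\varepsilon(p)\right)p^{1/4}\log p$.
   Context: "$\chi$ is constant on $(N,N+H]$" means that $\chi$ takes the same value at all the integers $N+1,\dots,N+H$. Here $\log$ is the natural logarithm and $e$ is its base. *)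

theory Defs
  imports "HOL-Analysis.Analysis" "HOL-Computational_Algebra.Primes"
begin

text \<open>A Dirichlet character is taken as a function on all of \<open>\<int>\<close>, extended by \<open>0\<close> to the
  integers not coprime to the modulus. The equation \<open>X 1 = 1\<close> is not listed: it follows from
  multiplicativity and \<open>X 1 \<noteq> 0\<close>.\<close>

definition dirichlet_character :: "nat \<Rightarrow> (int \<Rightarrow> complex) \<Rightarrow> bool" where
  "dirichlet_character n X \<longleftrightarrow>
     (\<forall>a b. X (a * b) = X a * X b) \<and>
     (\<forall>a. X (a + int n) = X a) \<and>
     (\<forall>a. X a = 0 \<longleftrightarrow> \<not> coprime a (int n))"

definition principal_character :: "nat \<Rightarrow> int \<Rightarrow> complex" where
  "principal_character n a = (if coprime a (int n) then 1 else 0)"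

end

theory Submission
  imports Defs "HOL-Computational_Algebra.Computational_Algebra"
    "HOL-Number_Theory.Number_Theory" "HOL-Real_Asymp.Real_Asymp"
begin

text \<open>If \<open>X\<close> is constant on the interval, then so is \<open>z\<^sup>s\<close> modulo \<open>p\<close> for \<open>s = (p - 1) / l\<close>, where \<open>l\<close>
  is a prime divisor of the order of \<open>X\<close>. Dilating the interval by \<open>1 / q\<close>, as Burgess does, turns it
  into many residues \<open>x\<close> such that \<open>x + 1, \<dots>, x + h\<close> all have the same \<open>s\<close>-th power. Each of
  them contributes \<open>h\<^bsup>2r\<^esup>\<close> to the number of solutions of
  \<open>\<Prod>(x + m\<^sub>i)\<^sup>s = \<Prod>(x + m'\<^sub>i)\<^sup>s\<close>, while every other \<open>x\<close> contributes at least \<open>h\<^bsup>2r\<^esup> / l\<close>, up to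
  few exceptions, by the Cauchy--Schwarz inequality over the \<open>l\<close> classes.

  Counting solutions in this way amounts to averaging the moments of all the powers of \<open>X\<close>, so
  that Weil's bound for a single character sum is not needed. It is enough to bound the number of \<open>x\<close> with
  \<open>F(x)\<^sup>s = G(x)\<^sup>s\<close> by \<open>p / l + O(r \<surd>p)\<close>, which Stepanov's auxiliary polynomial does directly. That
  polynomial is nonzero modulo \<open>p\<close> for a cheap reason: at a point where the order of \<open>F / G\<close>
  is not divisible by \<open>l\<close>, its terms have pairwise distinct orders of vanishing. The choice
  \<open>r \<approx> (ln p) / 4\<close>, \<open>h = 21 r\<close> gives the constant \<open>6\<close>, which is less than \<open>\<pi>e\<surd>6 / 3\<close>.\<close>

hide_const (open) up_ring.coeff up_ring.monom module.smult

section \<open>Integer polynomials modulo a prime\<close>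


lemma const_poly_dvd_imp_dvd_poly:
  fixes f :: "int poly"
  assumes "[:c:] dvd f"
  shows "c dvd poly f x"
  using assms by (metis dvdE dvd_triv_left poly_mult poly_const_conv poly_pCons mult_zero_right add_0_right poly_0)

lemma dvd_diff_common:
  fixes a b c d :: "'a :: comm_ring_1"
  assumes "d dvd a - b" "d dvd a - c"
  shows "d dvd c - b"
  using dvd_diff[OF assms] by simp

text \<open>With \<theta> f = L f', one step turns (X - x)^(k+1) U into (X - x)^k times L ((k+1) U +
  (X - x) U'), and the new cofactor takes the value (k+1) L(x) U(x) at x. The induction therefore
  runs over arbitrary \<open>i\<close> and \<open>U\<close>, and the factors collect to k!
  L(x)^k.\<close>

lemma derivation_chain_leading_value:
  fixes \<Phi> :: "nat \<Rightarrow> int poly"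
  assumes step: "\<And>k. k < M \<Longrightarrow> [:c:] dvd L * pderiv (\<Phi> k) - \<Phi> (Suc k)"
  shows "[:c:] dvd \<Phi> i - [:-x, 1:] ^ k * U \<Longrightarrow> i + k \<le> M \<Longrightarrow>
    c dvd poly (\<Phi> (i + k)) x - fact k * poly L x ^ k * poly U x"
proof (induction k arbitrary: i U)
  case 0
  then show ?case
    using const_poly_dvd_imp_dvd_poly[of c "\<Phi> i - U" x] by simp
next
  case (Suc k)
  let ?U = "L * (smult (1 + of_nat k) U + [:-x, 1:] * pderiv U)"
  obtain R where R: "\<Phi> i = [:-x, 1:] ^ Suc k * U + [:c:] * R"
    using Suc.prems(1) by (metis add.commute diff_add_cancel dvdE)
  have "pderiv (\<Phi> i) = [:-x, 1:] ^ k * (smult (1 + of_nat k) U + [:-x, 1:] * pderiv U) + [:c:] * pderiv R"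
    unfolding R pderiv_add pderiv_mult pderiv_power_Suc
    by (simp add: pderiv_pCons algebra_simps smult_add_left)
  then have "L * pderiv (\<Phi> i) - [:-x, 1:] ^ k * ?U = [:c:] * (L * pderiv R)"
    by (simp only: distrib_left mult.left_commute[of L] add_diff_cancel_left')
  then have "[:c:] dvd L * pderiv (\<Phi> i) - [:-x, 1:] ^ k * ?U" by (metis dvd_triv_left)
  moreover have "[:c:] dvd L * pderiv (\<Phi> i) - \<Phi> (Suc i)"
    using Suc.prems(2) by (intro step) simp
  ultimately have "[:c:] dvd \<Phi> (Suc i) - [:-x, 1:] ^ k * ?U"
    by (rule dvd_diff_common)
  from Suc.IH[OF this] Suc.prems(2) show ?case by (simp add: algebra_simps)
qed

lemma monic_dvd_mod_degree_le:
  fixes f W :: "int poly"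
  assumes nz: "\<not> [:c:] dvd f" and W: "lead_coeff W = 1" and dvd: "[:c:] dvd f - W * Q"
  shows "degree W \<le> degree f"
proof -
  \<comment> \<open>The coefficients become residues: a nonzero coefficient of \<open>Q'\<close> is
    not divisible by \<open>c\<close>, so the leading coefficient survives multiplication by the
    monic \<open>W\<close>.\<close>
  define Q' where "Q' = map_poly (\<lambda>a. a mod c) Q"
  have Q': "coeff Q' n = coeff Q n mod c" for n by (simp add: Q'_def coeff_map_poly)
  have "[:c:] dvd Q - Q'"
    by (simp add: const_poly_dvd_iff Q' minus_mod_eq_mult_div)
  then have "[:c:] dvd (f - W * Q) + W * (Q - Q')" using dvd by (intro dvd_add dvd_mult)
  then have d: "[:c:] dvd f - W * Q'" by (simp add: algebra_simps)
  have "Q' \<noteq> 0" using d nz by auto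
  then have "\<not> c dvd lead_coeff Q'"
    by (metis Q' leading_coeff_0_iff dvd_eq_mod_eq_0 mod_mod_trivial)
  moreover have "coeff (W * Q') (degree W + degree Q') = lead_coeff Q'"
    using W coeff_mult_degree_sum[of W Q'] by simp
  moreover have "c dvd coeff f (degree W + degree Q') - coeff (W * Q') (degree W + degree Q')"
    using d by (simp only: const_poly_dvd_iff coeff_diff)
  ultimately have "\<not> c dvd coeff f (degree W + degree Q')"
    by (metis dvd_diff_right_iff)
  then have "coeff f (degree W + degree Q') \<noteq> 0" by auto
  then show ?thesis using le_degree[of f "degree W + degree Q'"] by simp
qed

text \<open>Vanishing of the chain on \<open>S\<close> makes \<open>\<Phi> 0\<close> divisible
  modulo p by the product of all (X - x)^M with x in \<open>S\<close>. The bound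
  \<open>M \<le> p\<close> keeps k! invertible for k < M, so that the derivation detects
  multiplicities.\<close>

lemma card_roots_mult_le_degree_mod:
  fixes \<Phi> :: "nat \<Rightarrow> int poly"
  assumes p: "prime p" and fin: "finite S" and inj: "inj_on (\<lambda>x. x mod int p) S" and "M \<le> p"
    and step: "\<And>k. k < M \<Longrightarrow> [:int p:] dvd L * pderiv (\<Phi> k) - \<Phi> (Suc k)"
    and L: "\<And>x. x \<in> S \<Longrightarrow> \<not> int p dvd poly L x"
    and root: "\<And>k x. k < M \<Longrightarrow> x \<in> S \<Longrightarrow> int p dvd poly (\<Phi> k) x"
    and nz: "\<not> [:int p:] dvd \<Phi> 0"
  shows "M * card S \<le> degree (\<Phi> 0)"
proof -
  have ring_id: "f - b ^ Suc k * (V * Q') = (f - b ^ k * (V * Q)) + (b ^ k * V) * a"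
    if "Q = b * Q' + a" for f b V Q Q' a :: "int poly" and k
    using that by (simp add: algebra_simps)
  have "\<exists>Q. [:int p:] dvd \<Phi> 0 - (\<Prod>x\<in>T. [:-x, 1:] ^ M) * Q" if "finite T" "T \<subseteq> S" for T
    using that
  proof (induction T rule: finite_induct)
    case empty
    show ?case by (rule exI[of _ "\<Phi> 0"]) simp
  next
    case (insert y T)
    let ?V = "\<Prod>x\<in>T. [:-x, 1:] ^ M"
    from insert.prems have y: "y \<in> S" and T: "T \<subseteq> S" by auto
    have V: "\<not> int p dvd poly ?V y"
    proof
      assume "int p dvd poly ?V y"
      then have "int p dvd (\<Prod>x\<in>T. (y - x) ^ M)" by (simp add: poly_prod)
      then obtain x where x: "x \<in> T" "int p dvd (y - x) ^ M"
        using p insert.hyps(1) by (auto simp: prime_dvd_prod_iff)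
      then have "int p dvd y - x" using p by (metis prime_dvd_power prime_nat_int_transfer)
      then have "y mod int p = x mod int p" by (simp add: mod_eq_dvd_iff)
      then show False using inj y T x(1) insert.hyps(2) by (auto dest: inj_onD)
    qed
    \<comment> \<open>The factors X - y are split off one at a time: once k of them are present, the
      value of \<open>\<Phi> k\<close> at y is k! L(y)^k V(y) Q(y) modulo p, so Q vanishes at
      y.\<close>
    have "\<exists>Q. [:int p:] dvd \<Phi> 0 - [:-y, 1:] ^ k * (?V * Q)" if "k \<le> M" for k
      using that
    proof (induction k)
      case 0
      then show ?case using insert.IH[OF T] by simp
    next
      case (Suc k)
      then obtain Q where Q: "[:int p:] dvd \<Phi> 0 - [:-y, 1:] ^ k * (?V * Q)" by auto
      have "int p dvd poly (\<Phi> (0 + k)) y - fact k * poly L y ^ k * poly (?V * Q) y"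
        using Suc.prems by (intro derivation_chain_leading_value[OF step Q]) auto
      moreover have "int p dvd poly (\<Phi> k) y" using Suc.prems y by (intro root) auto
      ultimately have "int p dvd fact k * poly L y ^ k * poly (?V * Q) y"
        by (simp add: dvd_diff_right_iff)
      moreover have "\<not> int p dvd fact k"
      proof
        assume "int p dvd fact k"
        then have "p dvd fact k" by (metis int_dvd_int_iff of_nat_fact)
        then show False using p Suc.prems \<open>M \<le> p\<close> by (simp add: prime_dvd_fact_iff)
      qed
      ultimately have "int p dvd poly Q y"
        using p L[OF y] V prime_dvd_power[of "int p" "poly L y" k]
        by (auto simp: prime_dvd_mult_iff)
      then have "[:int p:] dvd [:poly Q y:]" by simp
      moreover have "[:-y, 1:] dvd Q - [:poly Q y:]" by (simp add: poly_eq_0_iff_dvd[symmetric])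
      then obtain Q' where "Q - [:poly Q y:] = [:-y, 1:] * Q'" by auto
      then have "Q = [:-y, 1:] * Q' + [:poly Q y:]" by (simp only: diff_eq_eq)
      then have "\<Phi> 0 - [:-y, 1:] ^ Suc k * (?V * Q') =
          (\<Phi> 0 - [:-y, 1:] ^ k * (?V * Q)) + ([:-y, 1:] ^ k * ?V) * [:poly Q y:]"
        by (rule ring_id)
      moreover have "[:int p:] dvd ([:-y, 1:] ^ k * ?V) * [:poly Q y:]"
        using calculation(1) by (rule dvd_mult)
      ultimately show ?case using dvd_add[OF Q] by metis
    qed
    from this[of M, OF order_refl] show ?case by (simp only: prod.insert[OF insert.hyps] mult.assoc)
  qed
  from this[OF fin order_refl] obtain Q where Q: "[:int p:] dvd \<Phi> 0 - (\<Prod>x\<in>S. [:-x, 1:] ^ M) * Q"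
    by blast
  have "lead_coeff (\<Prod>x\<in>S. [:-x, 1:] ^ M) = 1"
    by (simp add: lead_coeff_prod lead_coeff_power)
  from monic_dvd_mod_degree_le[OF nz this Q]
  have "degree (\<Prod>x\<in>S. [:-x, 1:] ^ M) \<le> degree (\<Phi> 0)" .
  moreover have "degree (\<Prod>x\<in>S. [:-x, 1:] ^ M) = M * card S"
    using fin by (subst degree_prod_eq_sum_degree) (simp_all add: degree_linear_power)
  ultimately show ?thesis by simp
qed

section \<open>Nonvanishing of sums and solvability of linear systems modulo a prime\<close>

text \<open>Among the terms whose coefficient is nonzero modulo p, the one of least order at 0 is
  alone in contributing to the power of x with that order, since the orders are distinct.\<close>

lemma lowest_term_not_dvd_mod:
  fixes U :: "'t \<Rightarrow> int poly" and c :: "'t \<Rightarrow> int"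
  assumes p: "prime p" and fin: "finite T" and inj: "inj_on \<nu> T"
    and U: "\<And>t. t \<in> T \<Longrightarrow> \<not> int p dvd poly (U t) 0"
    and t1: "t1 \<in> T" "\<not> int p dvd c t1"
  shows "\<not> [:int p:] dvd (\<Sum>t\<in>T. smult (c t) (monom 1 (\<nu> t) * U t))"
proof
  assume dvd: "[:int p:] dvd (\<Sum>t\<in>T. smult (c t) (monom 1 (\<nu> t) * U t))"
  obtain t0 where t0: "t0 \<in> T" "\<not> int p dvd c t0"
    and min: "\<And>t. t \<in> T \<Longrightarrow> \<not> int p dvd c t \<Longrightarrow> \<nu> t0 \<le> \<nu> t"
    using ex_has_least_nat[of "\<lambda>t. t \<in> T \<and> \<not> int p dvd c t" t1 \<nu>] t1 by auto
  have "int p dvd (\<Sum>t\<in>T. c t * coeff (monom 1 (\<nu> t) * U t) (\<nu> t0))"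
    using dvd by (auto simp: const_poly_dvd_iff coeff_sum dest: spec[of _ "\<nu> t0"])
  also have "(\<Sum>t\<in>T. c t * coeff (monom 1 (\<nu> t) * U t) (\<nu> t0)) =
    c t0 * poly (U t0) 0 + (\<Sum>t\<in>T - {t0}. c t * coeff (monom 1 (\<nu> t) * U t) (\<nu> t0))"
    using fin t0(1) by (simp add: sum.remove coeff_monom_mult poly_0_coeff_0)
  finally have 1: "int p dvd \<dots>" .
  have "int p dvd (\<Sum>t\<in>T - {t0}. c t * coeff (monom 1 (\<nu> t) * U t) (\<nu> t0))"
  proof (rule dvd_sum)
    fix t assume t: "t \<in> T - {t0}"
    then have "\<nu> t \<noteq> \<nu> t0" using inj t0(1) by (auto dest: inj_onD)
    then show "int p dvd c t * coeff (monom 1 (\<nu> t) * U t) (\<nu> t0)"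
      using min[of t] t by (cases "int p dvd c t") (auto simp: coeff_monom_mult)
  qed
  with 1 have "int p dvd c t0 * poly (U t0) 0" by (simp add: dvd_add_left_iff)
  then show False using p t0 U[OF t0(1)] by (auto simp: prime_dvd_mult_iff)
qed

text \<open>Pigeonhole: there are p^|T| vectors of unknowns and only p^|C| vectors of values. The
  difference of two vectors with equal values is a solution.\<close>

lemma linear_system_mod_nontrivial_solution:
  fixes e :: "'q \<Rightarrow> 't \<Rightarrow> int"
  assumes p: "p > 1" and T: "finite T" and C: "finite C" and card: "card C < card T"
  obtains c where "\<And>q. q \<in> C \<Longrightarrow> int p dvd (\<Sum>t\<in>T. c t * e q t)" "\<exists>t\<in>T. \<not> int p dvd c t"
proof -
  define f where "f = (\<lambda>c. restrict (\<lambda>q. (\<Sum>t\<in>T. c t * e q t) mod int p) C)"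
  let ?D = "T \<rightarrow>\<^sub>E {0..<int p}" and ?R = "C \<rightarrow>\<^sub>E {0..<int p}"
  have "f ` ?D \<subseteq> ?R" using p by (auto simp: f_def)
  moreover have "card ?R < card ?D" using p card T C by (simp add: card_PiE)
  moreover have "finite ?R" using C by (simp add: finite_PiE)
  ultimately have "\<not> inj_on f ?D" using card_inj_on_le by (metis linorder_not_le)
  then obtain c1 c2 where c: "c1 \<in> ?D" "c2 \<in> ?D" "c1 \<noteq> c2" "f c1 = f c2" by (auto simp: inj_on_def)
  show ?thesis
  proof (rule that[of "\<lambda>t. c1 t - c2 t"])
    fix q assume "q \<in> C"
    then have "(\<Sum>t\<in>T. c1 t * e q t) mod int p = (\<Sum>t\<in>T. c2 t * e q t) mod int p"
      using fun_cong[OF c(4), of q] by (simp add: f_def)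
    then have "int p dvd (\<Sum>t\<in>T. c1 t * e q t) - (\<Sum>t\<in>T. c2 t * e q t)" by (simp add: mod_eq_dvd_iff)
    then show "int p dvd (\<Sum>t\<in>T. (c1 t - c2 t) * e q t)"
      by (simp add: left_diff_distrib sum_subtractf)
  next
    obtain t where t: "t \<in> T" "c1 t \<noteq> c2 t" using c by (meson PiE_ext)
    have "\<not> int p dvd c1 t - c2 t"
    proof
      assume "int p dvd c1 t - c2 t"
      then have "c1 t mod int p = c2 t mod int p" by (simp add: mod_eq_dvd_iff)
      then show False using c(1,2) t by (auto dest!: PiE_mem)
    qed
    then show "\<exists>t\<in>T. \<not> int p dvd c1 t - c2 t" using t by blast
  qed
qed

section \<open>Stepanov's method\<close>

lemma fermat_little_int:
  fixes x :: int
  assumes "prime p" "\<not> int p dvd x"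
  shows "[x ^ (p - 1) = 1] (mod int p)"
proof -
  define y where "y = nat (x mod int p)"
  have "p > 0" using assms(1) by (simp add: prime_gt_0_nat)
  then have y: "int y = x mod int p" by (simp add: y_def)
  have "\<not> p dvd y" using assms(2) y by (metis int_dvd_int_iff dvd_mod_iff dvd_refl)
  then have "[y ^ (p - 1) = 1] (mod p)" using assms(1) by (intro fermat_theorem)
  then have "[int y ^ (p - 1) = 1] (mod int p)" by (metis cong_int_iff of_nat_1 of_nat_power)
  moreover have "[x = int y] (mod int p)" by (simp add: y cong_def)
  ultimately show ?thesis by (meson cong_pow cong_trans)
qed

lemma fermat_little_int':
  fixes x :: int
  assumes "prime p"
  shows "[x ^ p = x] (mod int p)"
proof (cases "int p dvd x")
  case True
  moreover have "int p dvd x ^ p" using True assms by (meson dvd_power dvd_trans prime_gt_0_nat)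
  ultimately show ?thesis by (simp add: cong_def dvd_eq_mod_eq_0)
next
  case False
  have "x ^ p = x ^ (p - 1) * x" using assms by (metis power_minus_mult prime_gt_0_nat)
  then show ?thesis using cong_mult[OF fermat_little_int[OF assms False] cong_refl[of x]] by simp
qed

text \<open>With \<open>\<theta> f = F G f'\<close>, the \<open>k\<close>-th iterate of \<open>\<theta>\<close> on \<open>P F\<^sup>m G\<^sup>n\<close> is
  \<open>log_deriv F G m n P k * F\<^sup>m G\<^sup>n\<close>.\<close>

primrec log_deriv :: "int poly \<Rightarrow> int poly \<Rightarrow> nat \<Rightarrow> nat \<Rightarrow> int poly \<Rightarrow> nat \<Rightarrow> int poly" where
  "log_deriv F G m n P 0 = P"
| "log_deriv F G m n P (Suc k) = F * G * pderiv (log_deriv F G m n P k) +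
     log_deriv F G m n P k * (smult (int m) (pderiv F * G) + smult (int n) (F * pderiv G))"

lemma pderiv_sum:
  fixes f :: "'a \<Rightarrow> 'b :: idom poly"
  shows "pderiv (sum f S) = (\<Sum>x\<in>S. pderiv (f x))"
  by (induction S rule: infinite_finite_induct) (simp_all add: pderiv_add)

lemma mult_pderiv_power:
  fixes F :: "int poly"
  shows "F * pderiv (F ^ m) = smult (int m) (pderiv F) * F ^ m"
  by (cases m) (simp_all add: pderiv_power_Suc del: power_Suc of_nat_Suc, simp add: mult_ac)

lemma mult_pderiv_log_deriv:
  "F * G * pderiv (log_deriv F G m n P k * F ^ m * G ^ n) = log_deriv F G m n P (Suc k) * F ^ m * G ^ n"
proof -
  have "F * G * pderiv (Q * F ^ m * G ^ n) =
    (F * G * pderiv Q) * F ^ m * G ^ n + Q * G * G ^ n * (F * pderiv (F ^ m))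
      + Q * F * F ^ m * (G * pderiv (G ^ n))" for Q
    by (simp add: pderiv_mult algebra_simps)
  from this[of "log_deriv F G m n P k"] show ?thesis
    unfolding mult_pderiv_power by (simp add: algebra_simps)
qed

lemma degree_log_deriv_le:
  assumes "degree F \<le> r" "degree G \<le> r"
  shows "degree (log_deriv F G m n P k) \<le> degree P + 2 * r * k"
proof (induction k)
  case (Suc k)
  let ?E = "log_deriv F G m n P k"
  have a: "degree (F * G * pderiv ?E) \<le> degree P + 2 * r * Suc k"
  proof -
    have "degree (F * G * pderiv ?E) \<le> degree (F * G) + degree (pderiv ?E)" by (rule degree_mult_le)
    moreover have "degree (F * G) \<le> degree F + degree G" by (rule degree_mult_le)
    moreover have "degree (pderiv ?E) \<le> degree ?E" by (simp add: degree_pderiv)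
    ultimately show ?thesis using assms Suc by simp
  qed
  have "degree (pderiv F * G) \<le> 2 * r"
    using degree_mult_le[of "pderiv F" G] assms degree_pderiv[of F] by linarith
  moreover have "degree (F * pderiv G) \<le> 2 * r"
    using degree_mult_le[of F "pderiv G"] assms degree_pderiv[of G] by linarith
  ultimately have "degree (smult (int m) (pderiv F * G) + smult (int n) (F * pderiv G)) \<le> 2 * r"
    by (meson degree_add_le degree_smult_le order.trans)
  then have "degree (?E * (smult (int m) (pderiv F * G) + smult (int n) (F * pderiv G)))
      \<le> degree P + 2 * r * Suc k"
    using degree_mult_le[of ?E "smult (int m) (pderiv F * G) + smult (int n) (F * pderiv G)"] Suc
    by simp
  with a show ?case by (simp add: degree_add_le)
qed simp

text \<open>These exponents are the orders at 0 of the terms of Stepanov's polynomial. An equality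
  of two of them, multiplied by l and reduced with l s = p - 1, makes l u - v d divisible by p,
  where u and v are the differences of \<alpha> and i, and d = a - b. Then \<open>small\<close>
  forces l u = v d; as l does not divide d and |v| < l, first v, then u and w vanish.\<close>

lemma inj_on_stepanov_exponent:
  fixes p l s a b r A B I :: nat
  assumes l: "prime l" and ls: "l * s = p - 1" and p: "prime p" and I: "I \<le> l"
    and ab: "a \<le> r" "b \<le> r" "a mod l \<noteq> b mod l"
    and small: "l * (A - 1) + (I - 1) * r < p"
  shows "inj_on (\<lambda>(\<alpha>, i, j). \<alpha> + a * (s * i) + b * (s * (I - 1 - i)) + p * j)
    ({..<A} \<times> {..<I} \<times> {..<B})"
proof (rule inj_onI)
  fix t t'
  assume t: "t \<in> {..<A} \<times> {..<I} \<times> {..<B}" "t' \<in> {..<A} \<times> {..<I} \<times> {..<B}"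
    and tt': "(case t of (\<alpha>, i, j) \<Rightarrow> \<alpha> + a * (s * i) + b * (s * (I - 1 - i)) + p * j) =
      (case t' of (\<alpha>, i, j) \<Rightarrow> \<alpha> + a * (s * i) + b * (s * (I - 1 - i)) + p * j)"
  obtain \<alpha> i j \<alpha>' i' j' where [simp]: "t = (\<alpha>, i, j)" "t' = (\<alpha>', i', j')"
    by (cases t, cases t')
  have b: "\<alpha> < A" "i < I" "\<alpha>' < A" "i' < I" using t by auto
  have eq: "\<alpha> + a * (s * i) + b * (s * (I - 1 - i)) + p * j =
      \<alpha>' + a * (s * i') + b * (s * (I - 1 - i')) + p * j'"
    using tt' by simp
  define u v w d where "u = int \<alpha> - int \<alpha>'" and "v = int i - int i'"
    and "w = int j - int j'" and "d = int a - int b"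
  have sub: "int (I - 1 - i) = int I - 1 - int i" "int (I - 1 - i') = int I - 1 - int i'"
    using b by (auto simp: of_nat_diff)
  have ls': "int l * int s = int p - 1"
    using ls p by (metis of_nat_1 of_nat_diff of_nat_mult prime_ge_1_nat)
  have "int (\<alpha> + a * (s * i) + b * (s * (I - 1 - i)) + p * j) =
      int (\<alpha>' + a * (s * i') + b * (s * (I - 1 - i')) + p * j')"
    using eq by (rule arg_cong)
  then have "u + int s * (v * d) + int p * w = 0"
    unfolding of_nat_add of_nat_mult sub by (simp add: u_def v_def w_def d_def algebra_simps)
  then have "int l * u + int l * int s * (v * d) + int p * (int l * w) = 0"
    by (metis (no_types, opaque_lifting) distrib_left mult.assoc mult.left_commute mult_zero_right)
  then have *: "int l * u - v * d = int p * (- (v * d) - int l * w)"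
    unfolding ls' by (simp add: algebra_simps)
  have "\<bar>u\<bar> \<le> int (A - 1)" using b by (auto simp: u_def)
  then have 1: "\<bar>int l * u\<bar> \<le> int (l * (A - 1))" by (simp add: abs_mult mult_left_mono)
  have "\<bar>v\<bar> \<le> int (I - 1)" "\<bar>d\<bar> \<le> int r" using b ab by (auto simp: v_def d_def)
  then have "\<bar>v * d\<bar> \<le> int ((I - 1) * r)" by (simp add: abs_mult mult_mono)
  then have "\<bar>int l * u - v * d\<bar> < int p" using 1 small by linarith
  moreover have "int p dvd int l * u - v * d" unfolding * by simp
  ultimately have 0: "int l * u - v * d = 0" using zdvd_not_zless
    by (metis abs_dvd_iff dvd_abs_iff zero_less_abs_iff)
  then have "int l dvd v * d" by (metis dvd_triv_left eq_iff_diff_eq_0)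
  moreover have "\<not> int l dvd d" using ab(3)
    by (simp add: d_def mod_eq_dvd_iff[symmetric] of_nat_mod[symmetric])
  ultimately have "int l dvd v" using l by (auto simp: prime_dvd_mult_iff)
  moreover have "\<bar>v\<bar> < int l" using b I by (auto simp: v_def)
  ultimately have v: "v = 0" by (metis abs_dvd_iff dvd_abs_iff zdvd_not_zless zero_less_abs_iff)
  with 0 l have u: "u = 0" by auto
  from * u v have "w = 0" using l p by (auto simp: prime_gt_0_nat)
  with u v show "t = t'" by (simp add: u_def v_def w_def)
qed

text \<open>\<open>A\<close>, \<open>I\<close> and \<open>B\<close> limit the exponents \<alpha>, i
  and j, and \<open>M\<close> is the order of vanishing on \<open>S\<close>. By \<open>count\<close>
  there are more coefficients than linear conditions; by \<open>small\<close> the terms have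
  distinct orders at 0. The conclusion compares the zeros with the degree.\<close>

theorem stepanov_bound:
  fixes F G F0 G0 :: "int poly" and p l s a b r A B I M :: nat
  assumes p: "prime p" and l: "prime l" and ls: "l * s = p - 1" and I: "I \<le> l"
    and F: "F = monom 1 a * F0" "\<not> int p dvd poly F0 0" "degree F \<le> r"
    and G: "G = monom 1 b * G0" "\<not> int p dvd poly G0 0" "degree G \<le> r"
    and ab: "a mod l \<noteq> b mod l"
    and S: "finite S" "inj_on (\<lambda>x. x mod int p) S"
    and SFG: "\<And>x. x \<in> S \<Longrightarrow> \<not> int p dvd poly (F * G) x"
    and SS: "\<And>x. x \<in> S \<Longrightarrow> [poly F x ^ s = poly G x ^ s] (mod int p)"
    and small: "l * (A - 1) + (I - 1) * r < p"
    and M: "M \<le> p" and count: "M * (A + B - 1) + r * (M * (M - 1)) < I * A * B"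
  shows "M * card S \<le> (A - 1) + p * (B - 1) + s * (I - 1) * r"
proof -
  have pos: "I > 0" "A > 0" "B > 0" using count by (auto intro!: Nat.gr0I)
  \<comment> \<open>The auxiliary polynomial \<open>\<Phi> 0\<close> has the terms \<open>c x\<^bsup>\<alpha> + pj\<^esup> F\<^bsup>si\<^esup> G\<^bsup>s(I - 1 - i)\<^esup>\<close>. On \<open>S\<close> the factor \<open>F\<^bsup>si\<^esup> G\<^bsup>s(I - 1 - i)\<^esup>\<close> does
    not depend on \<open>i\<close> and \<open>x\<^sup>p = x\<close>, hence the derivatives vanish there under few linear conditions.\<close>
  define T where "T = {..<A} \<times> {..<I} \<times> {..<B}"
  \<comment> \<open>At order k, the polynomial to be annihilated has degree at most (A - 1 + 2 r k)
    + (B - 1), hence A + B - 1 + 2 r k coefficients.\<close>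
  define C where "C = Sigma {..<M} (\<lambda>k. {..<A + B - 1 + 2 * r * k})"
  define E where "E = (\<lambda>k (\<alpha>, i, j :: nat). log_deriv F G (s * i) (s * (I - 1 - i)) (monom 1 \<alpha>) k)"
  define W where "W = (\<lambda>(\<alpha> :: nat, i, j :: nat). F ^ (s * i) * G ^ (s * (I - 1 - i)))"
  define jj where "jj = (\<lambda>(\<alpha> :: nat, i :: nat, j :: nat). j)"
  have "finite T" "finite C" by (auto simp: T_def C_def)
  have "(\<Sum>k<n. D + 2 * r * k) = n * D + r * (n * (n - 1))" for n D
  proof (induction n)
    case (Suc n)
    then show ?case by (cases n) (simp_all add: algebra_simps)
  qed simp
  then have "card C < card T"
    using count by (simp add: C_def T_def mult.assoc mult.left_commute[of A])
  have p1: "p > 1" using p by (rule prime_gt_1_nat)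
  define e where "e = (\<lambda>(k, n) t. coeff (E k t * monom 1 (jj t)) n)"
  obtain c where c: "\<And>q. q \<in> C \<Longrightarrow> int p dvd (\<Sum>t\<in>T. c t * e q t)"
    and "\<exists>t\<in>T. \<not> int p dvd c t"
    by (rule linear_system_mod_nontrivial_solution[OF p1 \<open>finite T\<close> \<open>finite C\<close> \<open>card C < card T\<close>,
      where e = e]) blast
  then obtain t1 where t1: "t1 \<in> T" "\<not> int p dvd c t1" by blast
  define \<Phi> where "\<Phi> = (\<lambda>k. \<Sum>t\<in>T. smult (c t) (E k t * W t * monom 1 (p * jj t)))"
  have degE: "degree (E k t) \<le> A - 1 + 2 * r * k" if t: "t \<in> T" for k t
  proof -
    obtain \<alpha> i j where [simp]: "t = (\<alpha>, i, j)" by (cases t)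
    have "degree (log_deriv F G (s * i) (s * (I - 1 - i)) (monom 1 \<alpha>) k) \<le> degree (monom (1::int) \<alpha>) + 2 * r * k"
      using F(3) G(3) by (rule degree_log_deriv_le)
    also have "degree (monom (1::int) \<alpha>) \<le> A - 1" using t by (auto simp: T_def degree_monom_eq)
    finally show ?thesis by (simp add: E_def)
  qed
  have "M * card S \<le> degree (\<Phi> 0)"
  proof (rule card_roots_mult_le_degree_mod[OF p S M _ SFG])
    fix k assume "k < M"
    \<comment> \<open>Modulo p the derivation treats x^(pj) as a constant, because its derivative
      carries the factor p.\<close>
    have "F * G * pderiv (E k t * W t * monom 1 (p * jj t)) - E (Suc k) t * W t * monom 1 (p * jj t) =
      [:int p:] * (F * G * E k t * W t * monom (int (jj t)) (p * jj t - 1))" for t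
    proof -
      have 1: "F * G * pderiv (E k t * W t) = E (Suc k) t * W t"
        using mult_pderiv_log_deriv[of F G _ _ _ k] by (auto simp: E_def W_def mult.assoc split: prod.splits)
      have 2: "pderiv (monom 1 (p * jj t)) = [:int p:] * monom (int (jj t)) (p * jj t - 1)"
        by (simp add: pderiv_monom smult_monom)
      have 3: "F * G * pderiv (Q * X) = F * G * pderiv Q * X + F * G * Q * pderiv X" for Q X
        by (simp add: pderiv_mult algebra_simps)
      show ?thesis unfolding 3[of "E k t * W t"] 1 2 by (simp add: mult_ac)
    qed
    then have "[:int p:] dvd (F * G * pderiv (E k t * W t * monom 1 (p * jj t)) - E (Suc k) t * W t * monom 1 (p * jj t))" for t
      by (metis dvd_triv_left)
    then have "[:int p:] dvd (\<Sum>t\<in>T. smult (c t) (F * G * pderiv (E k t * W t * monom 1 (p * jj t)) - E (Suc k) t * W t * monom 1 (p * jj t)))"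
      by (intro dvd_sum dvd_smult)
    also have "\<dots> = F * G * pderiv (\<Phi> k) - \<Phi> (Suc k)"
      by (simp add: \<Phi>_def pderiv_sum pderiv_smult sum_distrib_left smult_diff_right sum_subtractf)
    finally show "[:int p:] dvd F * G * pderiv (\<Phi> k) - \<Phi> (Suc k)" .
  next
    fix k x assume k: "k < M" and x: "x \<in> S"
    \<comment> \<open>The linear conditions annihilate the polynomial obtained by replacing x^p with
      x; its coefficients outside the range of \<open>C\<close> vanish by degree.\<close>
    have "[:int p:] dvd (\<Sum>t\<in>T. smult (c t) (E k t * monom 1 (jj t)))"
      unfolding const_poly_dvd_iff
    proof
      fix n
      show "int p dvd coeff (\<Sum>t\<in>T. smult (c t) (E k t * monom 1 (jj t))) n"
      proof (cases "n < A + B - 1 + 2 * r * k")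
        case True
        then have "(k, n) \<in> C" using k by (auto simp: C_def)
        from c[OF this] show ?thesis by (simp add: coeff_sum e_def)
      next
        case False
        have "coeff (E k t * monom 1 (jj t)) n = 0" if t: "t \<in> T" for t
        proof (rule coeff_eq_0)
          have "degree (E k t * monom 1 (jj t)) \<le> degree (E k t) + degree (monom (1::int) (jj t))"
            by (rule degree_mult_le)
          moreover have "degree (monom (1::int) (jj t)) \<le> B - 1"
            using t by (auto simp: T_def jj_def degree_monom_eq)
          ultimately show "degree (E k t * monom 1 (jj t)) < n"
            using degE[OF t, of k] False pos by linarith
        qed
        then show ?thesis by (simp add: coeff_sum)
      qed
    qed
    then have 0: "int p dvd (\<Sum>t\<in>T. c t * (poly (E k t) x * x ^ jj t))"
      using const_poly_dvd_imp_dvd_poly[of "int p" _ x] by (fastforce simp: poly_sum poly_monom)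
    have "[poly (\<Phi> k) x = (\<Sum>t\<in>T. c t * (poly (E k t) x * poly F x ^ (s * (I - 1)) * x ^ jj t))] (mod int p)"
      unfolding \<Phi>_def poly_sum
    proof (rule cong_sum)
      fix t assume t: "t \<in> T"
      obtain \<alpha> i j where [simp]: "t = (\<alpha>, i, j)" by (cases t)
      have i: "i < I" using t by (simp add: T_def)
      have "[(poly F x ^ s) ^ i * (poly G x ^ s) ^ (I - 1 - i) = (poly F x ^ s) ^ i * (poly F x ^ s) ^ (I - 1 - i)] (mod int p)"
        by (rule cong_mult[OF cong_refl cong_pow[OF cong_sym[OF SS[OF x]]]])
      also have "(poly F x ^ s) ^ i * (poly F x ^ s) ^ (I - 1 - i) = poly F x ^ (s * (I - 1))"
        using i by (simp flip: power_mult power_add distrib_left)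
      finally have W: "[poly (W t) x = poly F x ^ (s * (I - 1))] (mod int p)"
        by (simp add: W_def power_mult)
      have "[(x ^ p) ^ j = x ^ j] (mod int p)" by (intro cong_pow fermat_little_int' p)
      then have "[x ^ (p * jj t) = x ^ jj t] (mod int p)" by (simp add: jj_def power_mult)
      with W show "[poly (smult (c t) (E k t * W t * monom 1 (p * jj t))) x =
         c t * (poly (E k t) x * poly F x ^ (s * (I - 1)) * x ^ jj t)] (mod int p)"
        by (auto simp: poly_monom intro!: cong_mult)
    qed
    also have "(\<Sum>t\<in>T. c t * (poly (E k t) x * poly F x ^ (s * (I - 1)) * x ^ jj t)) =
       poly F x ^ (s * (I - 1)) * (\<Sum>t\<in>T. c t * (poly (E k t) x * x ^ jj t))"
      by (simp add: sum_distrib_left mult_ac)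
    finally show "int p dvd poly (\<Phi> k) x" using 0 by (meson cong_dvd_iff dvd_mult)
  next
    \<comment> \<open>For the behaviour at 0, the powers x^a and x^b are pulled out of F and G: each
      term is x^\<nu> times a factor that is nonzero modulo p at 0.\<close>
    define U where "U = (\<lambda>(\<alpha> :: nat, i, j :: nat). F0 ^ (s * i) * G0 ^ (s * (I - 1 - i)))"
    define \<nu> where "\<nu> = (\<lambda>(\<alpha>, i, j). \<alpha> + a * (s * i) + b * (s * (I - 1 - i)) + p * j)"
    have "F0 \<noteq> 0" "G0 \<noteq> 0" using F(2) G(2) by auto
    then have "a \<le> r" "b \<le> r"
      using F(3) G(3) unfolding F(1) G(1) by (simp_all add: degree_mult_eq degree_monom_eq)
    then have "inj_on \<nu> T" unfolding \<nu>_def T_def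
      by (intro inj_on_stepanov_exponent[OF l ls p I _ _ ab small])
    moreover have "\<not> int p dvd poly (U t) 0" for t
      using F(2) G(2) p by (auto simp: U_def prime_dvd_mult_iff split: prod.splits
        dest!: prime_dvd_power[rotated])
    ultimately have "\<not> [:int p:] dvd (\<Sum>t\<in>T. smult (c t) (monom 1 (\<nu> t) * U t))"
      by (intro lowest_term_not_dvd_mod[where c = c and ?t1.0 = t1, OF p \<open>finite T\<close> _ _ t1])
    also have "(\<Sum>t\<in>T. smult (c t) (monom 1 (\<nu> t) * U t)) = \<Phi> 0"
      unfolding \<Phi>_def
    proof (rule sum.cong[OF refl])
      fix t :: "nat \<times> nat \<times> nat"
      obtain \<alpha> i j where [simp]: "t = (\<alpha>, i, j)" by (cases t)
      have "monom 1 (\<nu> t) = monom 1 \<alpha> * monom 1 a ^ (s * i) * monom 1 b ^ (s * (I - 1 - i)) * monom (1::int) (p * j)"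
        by (simp add: \<nu>_def monom_power mult_monom)
      then show "smult (c t) (monom 1 (\<nu> t) * U t) = smult (c t) (E 0 t * W t * monom 1 (p * jj t))"
        by (simp add: E_def W_def U_def jj_def F(1) G(1) power_mult_distrib mult_ac)
    qed
    finally show "\<not> [:int p:] dvd \<Phi> 0" .
  qed
  also have "degree (\<Phi> 0) \<le> (A - 1) + p * (B - 1) + s * (I - 1) * r"
    unfolding \<Phi>_def
  proof (intro degree_sum_le \<open>finite T\<close> order.trans[OF degree_smult_le])
    fix t assume t: "t \<in> T"
    obtain \<alpha> i j where [simp]: "t = (\<alpha>, i, j)" by (cases t)
    have i: "i < I" "j < B" using t by (auto simp: T_def)
    have "degree (E 0 t * W t * monom 1 (p * jj t)) \<le> degree (E 0 t) + degree (W t) + degree (monom (1::int) (p * jj t))"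
      by (meson add_mono degree_mult_le le_trans order_refl)
    moreover have "degree (monom (1::int) (p * jj t)) \<le> p * (B - 1)"
      using i by (auto simp: degree_monom_eq jj_def)
    moreover have "degree (E 0 t) \<le> A - 1" using degE[OF t, of 0] by simp
    moreover have "degree (W t) \<le> s * (I - 1) * r"
    proof -
      have "degree (F ^ (s * i)) \<le> degree F * (s * i)" "degree (G ^ (s * (I - 1 - i))) \<le> degree G * (s * (I - 1 - i))"
        by (rule degree_power_le)+
      then have "degree (W t) \<le> degree F * (s * i) + degree G * (s * (I - 1 - i))"
        using degree_mult_le[of "F ^ (s * i)" "G ^ (s * (I - 1 - i))"] by (simp add: W_def)
      also have "\<dots> \<le> r * (s * i) + r * (s * (I - 1 - i))"
        using F(3) G(3) by (intro add_mono mult_right_mono) auto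
      also have "\<dots> = s * (I - 1) * r"
        using i by (simp flip: distrib_left)
      finally show ?thesis .
    qed
    ultimately show "degree (E 0 t * W t * monom 1 (p * jj t)) \<le> (A - 1) + p * (B - 1) + s * (I - 1) * r"
      by linarith
  qed
  finally show ?thesis .
qed

section \<open>Parameters for Stepanov's method, with M close to the square root of p\<close>

text \<open>The choice is A = s + 1 - r, B = M div l + r + 2, I = l. Of the B copies of l A, the
  first M div l + 1 exceed M A because l (M div l + 1) > M. The other r + 1 copies amount to about
  (r + 1) p, which pays for the remaining terms of size at most about (r + 1/2) M^2; the lower order
  terms are absorbed by M \<ge> 2 r (r + 1) + 2.\<close>

lemma stepanov_parameter_count:
  fixes M l r s p :: nat
  assumes ls: "l * s + 1 = p" and l: "2 \<le> l" "l \<le> M" and M: "M * M \<le> p" "2 * r * (r + 1) + 2 \<le> M"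
  shows "r \<le> s"
    and "M * ((s + 1 - r) + (M div l + r + 2) - 1) + r * (M * (M - 1)) < l * (s + 1 - r) * (M div l + r + 2)"
proof -
  have rM: "r + 1 < M" using M(2) by (cases r) auto
  show rs: "r \<le> s"
  proof (rule ccontr)
    assume "\<not> r \<le> s"
    then have "s + 1 \<le> r" by simp
    then have "l * (s + 1) \<le> M * r" using l(2) by (intro mult_mono) auto
    moreover have "M * r + M \<le> M * M" using rM mult_le_mono2[of "r + 1" M M] by simp
    ultimately show False using ls M(1) l by simp
  qed
  define u where "u = M div l"
  define A where "A = int s + 1 - int r"
  have "M < l * (u + 1)" using l unfolding u_def
    by (metis One_nat_def add.commute dividend_less_times_div less_le_trans mult_Suc_right plus_1_eq_Suc pos2)
  then have u1: "int M + 1 \<le> int l * (int u + 1)" by (metis Suc_eq_plus1 Suc_leI of_nat_1 of_nat_add of_nat_le_iff of_nat_mult)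
  have "2 * u \<le> l * u" using l(1) by simp
  also have "\<dots> \<le> M" by (simp add: u_def)
  finally have u2: "2 * int u \<le> int M" by linarith
  have A: "A \<ge> 1" using rs by (simp add: A_def)
  have lA: "int l * A \<ge> int p + 1 - int M * int r"
  proof -
    have "int l * A = int p - 1 + int l - int l * int r"
      using ls by (simp add: A_def algebra_simps flip: of_nat_mult)
    moreover have "int l * int r \<le> int M * int r" using l by (intro mult_right_mono) auto
    ultimately show ?thesis using l(1) by linarith
  qed
  have "2 * (int M * (int u + int r + 1)) \<le> int M * (int M + 2 * int r + 2)"
    using u2 mult_left_mono[of "2 * int u + 2 * int r + 2" "int M + 2 * int r + 2" "int M"]
    by (simp add: algebra_simps)
  moreover have "(int r + 1) * (int M * int M + 1 - int M * int r) \<le> (int r + 1) * (int l * A)"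
    using lA M(1) by (intro mult_left_mono) (simp_all flip: of_nat_mult)
  moreover have "int M * (2 * int r * (int r + 1) + 2) \<le> int M * int M"
  proof (rule mult_left_mono)
    show "2 * int r * (int r + 1) + 2 \<le> int M" using M(2)
      by (metis (mono_tags) of_nat_1 of_nat_add of_nat_le_iff of_nat_mult of_nat_numeral)
  qed simp
  ultimately have "int M * (int u + int r + 1) + int r * (int M * (int M - 1)) < (int r + 1) * (int l * A)"
    by (simp add: algebra_simps)
  moreover have "A * (int M + 1) \<le> A * (int l * (int u + 1))" using u1 A by (intro mult_left_mono) auto
  ultimately have "int M * (A + (int u + int r + 2) - 1) + int r * (int M * (int M - 1))
      < int l * A * (int u + int r + 2)"
    using A by (simp add: algebra_simps)
  moreover have "A = int (s + 1 - r)" using rs by (simp add: A_def of_nat_diff)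
  moreover have "int M - 1 = int (M - 1)" using rM by (simp add: of_nat_diff)
  moreover have "int (s + 1 - r) + (int u + int r + 2) - 1 = int ((s + 1 - r) + (u + r + 2) - 1)"
    using rs by (simp add: of_nat_diff)
  ultimately have "int (M * ((s + 1 - r) + (u + r + 2) - 1) + r * (M * (M - 1))) < int (l * (s + 1 - r) * (u + r + 2))"
    by (metis (mono_tags, opaque_lifting) of_nat_add of_nat_mult of_nat_numeral)
  then show "M * ((s + 1 - r) + (M div l + r + 2) - 1) + r * (M * (M - 1)) < l * (s + 1 - r) * (M div l + r + 2)"
    unfolding u_def of_nat_less_iff .
qed

text \<open>With M the integer part of \<open>sqrt p\<close>, the degree is at most M p / l + (2 r +
  2) p, and division by M gives the claim. These parameters require l \<le> M; for larger l the
  exponent s is at most M + 2, and the bound s r on the number of points suffices.\<close>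

corollary stepanov_bound_sqrt:
  fixes F G F0 G0 :: "int poly" and p l s a b r :: nat
  assumes p: "prime p" and l: "prime l" and ls: "l * s = p - 1"
    and F: "F = monom 1 a * F0" "\<not> int p dvd poly F0 0" "degree F \<le> r"
    and G: "G = monom 1 b * G0" "\<not> int p dvd poly G0 0" "degree G \<le> r"
    and ab: "a mod l \<noteq> b mod l"
    and S: "finite S" "inj_on (\<lambda>x. x mod int p) S"
    and SFG: "\<And>x. x \<in> S \<Longrightarrow> \<not> int p dvd poly (F * G) x"
    and SS: "\<And>x. x \<in> S \<Longrightarrow> [poly F x ^ s = poly G x ^ s] (mod int p)"
    and large: "2 * real r * (real r + 1) + 3 \<le> sqrt p"
  shows "real (card S) \<le> p / l + (2 * real r + 2) * (sqrt p + 2)"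
proof -
  define M where "M = nat \<lfloor>sqrt p\<rfloor>"
  have M: "real M \<le> sqrt p" "sqrt p < M + 1" unfolding M_def by (simp_all, linarith)
  have "real M * real M \<le> sqrt p * sqrt p" using M by (intro mult_mono) auto
  then have MM: "M * M \<le> p" by (metis real_sqrt_mult_self abs_of_nat of_nat_le_iff of_nat_mult)
  have "sqrt p * sqrt p < real (M + 1) * real (M + 1)" using M(2) by (intro mult_strict_mono') auto
  then have "real p < real ((M + 1) * (M + 1))"
    by (simp only: of_nat_mult real_sqrt_mult_self abs_of_nat)
  then have "p < (M + 1) * (M + 1)" unfolding of_nat_less_iff .
  \<comment> \<open>The form M (M + 2) makes p / M at most M + 2 in the final division.\<close>
  then have pM: "p \<le> M * (M + 2)" by simp
  have "real (2 * r * (r + 1) + 2) < real (M + 1) - 0" using M(2) large by (simp add: algebra_simps)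
  then have M2: "2 * r * (r + 1) + 2 \<le> M" by linarith
  have p1: "p > 1" using p by (rule prime_gt_1_nat)
  have l2: "2 \<le> l" using l by (rule prime_ge_2_nat)
  have ls1: "l * s + 1 = p" using ls p1 by simp
  have sp: "real s \<le> p / l" using ls1 l2 by (simp add: field_simps flip: of_nat_mult)
  have M0: "M > 0" using M2 by simp
  show ?thesis
  proof (cases "l \<le> M")
    case True
    note par = stepanov_parameter_count[OF ls1 l2 True MM M2]
    \<comment> \<open>The choice A = s + 1 - r is made for this: the condition \<open>small\<close>
      becomes l s - r < p.\<close>
    have eq: "l * (s + 1 - r - 1) + (l - 1) * r = l * s - r"
    proof -
      have "l * (s - r) + l * r = l * s" using par(1) by (simp flip: distrib_left)
      moreover have "(l - 1) * r + r = l * r" using l2 by (simp add: diff_mult_distrib)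
      ultimately show ?thesis by simp
    qed
    have "M * card S \<le> (s + 1 - r - 1) + p * (M div l + r + 2 - 1) + s * (l - 1) * r"
    proof (rule stepanov_bound[OF p l ls _ F G ab S SFG SS _ _ par(2)])
      show "l * (s + 1 - r - 1) + (l - 1) * r < p" unfolding eq using ls1 by simp
      show "M \<le> p" using MM M0 by (metis le_trans le_square)
    qed auto
    then have "real (M * card S) \<le> real ((s + 1 - r - 1) + p * (M div l + r + 2 - 1) + s * (l - 1) * r)"
      unfolding of_nat_le_iff .
    also have "\<dots> \<le> real s + real p * (real (M div l) + r + 1) + real p * real r"
    proof -
      have "s * (l - 1) \<le> p" using ls1 by (cases l) (auto simp: mult.commute)
      then have "real (s * (l - 1) * r) \<le> real (p * r)" unfolding of_nat_le_iff by (intro mult_le_mono1)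
      then show ?thesis using par(1) by (simp add: of_nat_diff algebra_simps)
    qed
    also have "\<dots> \<le> real p + real p * (M / l + r + 1) + real p * r"
    proof -
      have "s \<le> p" using ls1 l2 by (metis le_add1 le_trans mult_le_mono1 nat_mult_1 one_le_numeral)
      moreover have "real (M div l) \<le> M / l" by (rule of_nat_div_le_of_nat)
      then have "real p * (real (M div l) + r + 1) \<le> real p * (M / l + r + 1)" by (intro mult_left_mono) auto
      ultimately show ?thesis by linarith
    qed
    also have "\<dots> = M * (p / l) + (2 * real r + 2) * real p" by (simp add: field_simps)
    also have "\<dots> \<le> M * (p / l) + (2 * real r + 2) * (real M * (real M + 2))"
    proof -
      have "real p \<le> real (M * (M + 2))" using pM unfolding of_nat_le_iff .
      then have "real p \<le> real M * (real M + 2)" by (simp add: algebra_simps)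
      then show ?thesis by (intro add_left_mono mult_left_mono) auto
    qed
    also have "\<dots> = M * (p / l + (2 * real r + 2) * (real M + 2))" by (simp add: algebra_simps)
    finally have "real M * card S \<le> real M * (p / l + (2 * real r + 2) * (real M + 2))" by simp
    then have "real (card S) \<le> p / l + (2 * real r + 2) * (real M + 2)" using M0 by (simp add: mult_le_cancel_left_pos)
    also have "\<dots> \<le> p / l + (2 * real r + 2) * (sqrt p + 2)"
      using M(1) by (intro add_left_mono mult_left_mono) auto
    finally show ?thesis .
  next
    case False
    \<comment> \<open>Here \<open>F\<^sup>s - G\<^sup>s\<close> serves as the auxiliary polynomial: \<open>M = A = B = 1\<close>, \<open>I = 2\<close>.\<close>
    have "r < p"
    proof -
      have "r < M" using M2 by (cases r) auto
      also have "M \<le> p" using MM M0 by (metis le_trans le_square)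
      finally show ?thesis .
    qed
    then have "1 * card S \<le> (1 - 1) + p * (1 - 1) + s * (2 - 1) * r"
      using p1 l2 by (intro stepanov_bound[OF p l ls _ F G ab S SFG SS]) auto
    then have "real (card S) \<le> real s * real r" by (simp flip: of_nat_mult)
    also have "real s \<le> M + 2"
    proof -
      have "s * M \<le> l * s" using False by simp
      also have "\<dots> \<le> (M + 2) * M" using ls1 pM by simp
      finally have "s \<le> M + 2" using M0 by (simp only: mult_le_cancel2)
      then show ?thesis by linarith
    qed
    then have "real s * real r \<le> (sqrt p + 2) * (2 * real r + 2)" using M(1) by (intro mult_mono) auto
    finally show ?thesis by (smt (verit) divide_nonneg_nonneg mult.commute of_nat_0_le_iff)
  qed
qed

section \<open>Counting multiplicative collisions\<close>

lemma card_collisions_ge: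
  assumes "finite S" "finite K" "\<kappa> ` S \<subseteq> K"
  shows "(real (card S))\<^sup>2 \<le> real (card K) * real (card {(x, y) \<in> S \<times> S. \<kappa> x = \<kappa> y})"
proof -
  let ?N = "\<lambda>c. {x \<in> S. \<kappa> x = c}"
  have "{(x, y) \<in> S \<times> S. \<kappa> x = \<kappa> y} = (\<Union>c\<in>K. ?N c \<times> ?N c)" using assms(3) by auto
  also have "card \<dots> = (\<Sum>c\<in>K. card (?N c \<times> ?N c))"
    using assms by (intro card_UN_disjoint) auto
  also have "\<dots> = (\<Sum>c\<in>K. (card (?N c))\<^sup>2)" by (simp add: card_cartesian_product power2_eq_square)
  finally have 1: "real (card {(x, y) \<in> S \<times> S. \<kappa> x = \<kappa> y}) = (\<Sum>c\<in>K. (real (card (?N c)))\<^sup>2)" by simp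
  have "card S = (\<Sum>c\<in>K. card (?N c))"
    using sum.group[OF assms, of "\<lambda>_. 1::nat"] by simp
  then have "real (card S) = (\<Sum>c\<in>K. real (card (?N c)))" by simp
  then have "(real (card S))\<^sup>2 \<le> real (card K) * (\<Sum>c\<in>K. (real (card (?N c)))\<^sup>2)"
    using sum_squared_le_sum_of_squares[of "\<lambda>c. real (card (?N c))" K] by (simp add: mult.commute)
  then show ?thesis unfolding 1 .
qed

lemma card_roots_of_unity_mod_le:
  fixes S :: "int set"
  assumes p: "prime p" and l: "l > 0" and S: "S \<subseteq> {0..<int p}" "\<And>c. c \<in> S \<Longrightarrow> [c ^ l = 1] (mod int p)"
  shows "card S \<le> l"
proof -
  let ?f = "monom 1 l - 1 :: int poly"
  \<comment> \<open>The degree bound is applied with M = 1, so the chain consists of x^l - 1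
    followed by its derivative.\<close>
  define \<Phi> where "\<Phi> k = (if k = 0 then ?f else pderiv ?f)" for k :: nat
  have p1: "p > 1" using p by (rule prime_gt_1_nat)
  have "coeff ?f l = 1" using l by simp
  have "1 * card S \<le> degree (\<Phi> 0)"
  proof (rule card_roots_mult_le_degree_mod[OF p, where L = 1])
    show "finite S" using S(1) by (rule finite_subset) simp
    show "inj_on (\<lambda>x. x mod int p) S" using S(1) by (auto simp: inj_on_def subset_iff)
    show "\<not> [:int p:] dvd \<Phi> 0"
      using \<open>coeff ?f l = 1\<close> p1 unfolding \<Phi>_def const_poly_dvd_iff by (auto intro!: exI[of _ l])
    show "int p dvd poly (\<Phi> k) x" if "k < 1" "x \<in> S" for k x
      using S(2)[OF that(2)] that(1) by (simp add: \<Phi>_def poly_monom cong_iff_dvd_diff)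
  qed (use p1 in \<open>auto simp: \<Phi>_def\<close>)
  also have "degree (\<Phi> 0) \<le> l"
    unfolding \<Phi>_def by (auto intro!: degree_diff_le simp: degree_monom_le)
  finally show ?thesis by simp
qed

text \<open>r^r / r! is a single term of the exponential series at r.\<close>

lemma self_power_le_exp_fact: "real r ^ r \<le> exp (real r) * fact r"
proof -
  have "(\<Sum>n\<in>{r}. real r ^ n /\<^sub>R fact n) \<le> (\<Sum>n. real r ^ n /\<^sub>R fact n)"
    by (rule sum_le_suminf[OF summable_exp_generic]) auto
  then show ?thesis by (simp add: exp_def divide_simps split: if_splits)
qed

lemma binomial_self_power_le: "real ((h choose r) * r ^ (2 * r)) \<le> (exp 1 * r * h) ^ r"
proof -
  have "real ((h choose r) * r ^ (2 * r)) * fact r = real ((h choose r) * fact r) * (real r ^ r * real r ^ r)"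
    by (simp add: power_add mult_2)
  also have "\<dots> \<le> real (h ^ r) * (real r ^ r * (exp (real r) * fact r))"
  proof (rule mult_mono)
    show "real ((h choose r) * fact r) \<le> real (h ^ r)"
      using binomial_fact_pow[of h r] unfolding of_nat_le_iff by simp
    show "real r ^ r * real r ^ r \<le> real r ^ r * (exp (real r) * fact r)"
      by (intro mult_left_mono self_power_le_exp_fact) auto
  qed auto
  also have "\<dots> = (exp 1 * r * h) ^ r * fact r"
    by (simp add: power_mult_distrib exp_of_nat_mult[of r 1, simplified] mult_ac)
  finally show ?thesis by simp
qed

section \<open>Tuples of shifts and degenerate pairs\<close>

definition tuples :: "nat \<Rightarrow> nat \<Rightarrow> (nat \<Rightarrow> int) set" where
  "tuples h r = {..<r} \<rightarrow>\<^sub>E {1..int h}"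

definition shift_prod :: "nat \<Rightarrow> int \<Rightarrow> (nat \<Rightarrow> int) \<Rightarrow> int" where
  "shift_prod r x m = (\<Prod>i<r. x + m i)"

text \<open>For \<open>shift_prod r x m\<close> as a polynomial in x, this is the order of vanishing
  at x = -v.\<close>

definition mult_count :: "nat \<Rightarrow> (nat \<Rightarrow> int) \<Rightarrow> int \<Rightarrow> nat" where
  "mult_count r m v = card {i \<in> {..<r}. m i = v}"

lemma finite_tuples [simp]: "finite (tuples h r)"
  by (simp add: tuples_def finite_PiE)

lemma card_tuples: "card (tuples h r) = h ^ r"
  by (simp add: tuples_def card_PiE)

text \<open>Every value of a degenerate pair occurs at least twice among its \<open>2r\<close> entries, hence there are at most \<open>r\<close> values.\<close>

lemma card_degenerate_pairs_le:
  assumes "l \<ge> 2" "r \<le> h"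
  shows "card {(m, m') \<in> tuples h r \<times> tuples h r. \<forall>v. mult_count r m v mod l = mult_count r m' v mod l}
    \<le> (h choose r) * r ^ (2 * r)" (is "card ?B \<le> _")
proof -
  let ?\<R> = "{R. R \<subseteq> {1..int h} \<and> card R = r}"
  let ?P = "\<lambda>R. ({..<r} \<rightarrow>\<^sub>E R) \<times> ({..<r} \<rightarrow>\<^sub>E R)"
  have "?B \<subseteq> (\<Union>R\<in>?\<R>. ?P R)"
  proof clarify
    fix m m' assume m: "m \<in> tuples h r" "m' \<in> tuples h r"
      and eq: "\<forall>v. mult_count r m v mod l = mult_count r m' v mod l"
    define V where "V = m ` {..<r} \<union> m' ` {..<r}"
    have finV: "finite V" by (simp add: V_def)
    have count: "(\<Sum>v\<in>V. mult_count r n v) = r" if "n ` {..<r} \<subseteq> V" for n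
      using sum.group[OF _ finV that, of "\<lambda>_. 1::nat"] by (simp add: mult_count_def)
    \<comment> \<open>If both counts are positive, their sum is at least 2; otherwise one is 0 and
      the other is a positive multiple of l.\<close>
    have "2 \<le> mult_count r m v + mult_count r m' v" if "v \<in> V" for v
    proof -
      have "mult_count r m v > 0 \<or> mult_count r m' v > 0"
        using that by (auto simp: V_def mult_count_def card_gt_0_iff)
      moreover have "mult_count r m v mod l = mult_count r m' v mod l" using eq by blast
      ultimately show ?thesis using assms(1)
        by (cases "mult_count r m v = 0 \<or> mult_count r m' v = 0") (auto simp: mod_eq_0_iff_dvd dest!: dvd_imp_le)
    qed
    then have "(\<Sum>v\<in>V. 2) \<le> (\<Sum>v\<in>V. mult_count r m v + mult_count r m' v)" by (rule sum_mono)
    also have "\<dots> = 2 * r" using count[of m] count[of m'] by (simp add: sum.distrib V_def)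
    finally have "card V \<le> r" by simp
    moreover have "V \<subseteq> {1..int h}" using m by (auto simp: V_def tuples_def)
    \<comment> \<open>Enlarging \<open>V\<close> to exactly r values covers all degenerate pairs by
      (h choose r) families of r^(2r) pairs each.\<close>
    ultimately obtain R where R: "V \<subseteq> R" "R \<subseteq> {1..int h}" "card R = r"
      using exists_subset_between[of V r "{1..int h}"] assms(2) by auto
    then have "m \<in> {..<r} \<rightarrow>\<^sub>E R" "m' \<in> {..<r} \<rightarrow>\<^sub>E R"
      using m by (auto simp: tuples_def V_def PiE_iff)
    with R show "(m, m') \<in> (\<Union>R\<in>?\<R>. ?P R)" by blast
  qed
  moreover have fin: "finite ?\<R>" by (rule finite_subset[of _ "Pow {1..int h}"]) auto
  have "finite (?P R)" if "R \<in> ?\<R>" for R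
    using that finite_subset[of R "{1..int h}"] by (auto intro!: finite_PiE)
  then have "finite (\<Union>R\<in>?\<R>. ?P R)" using fin by blast
  ultimately have "card ?B \<le> card (\<Union>R\<in>?\<R>. ?P R)" by (intro card_mono)
  also have "\<dots> \<le> (\<Sum>R\<in>?\<R>. card (?P R))" by (rule card_UN_le[OF fin])
  also have "\<dots> = (\<Sum>R\<in>?\<R>. r ^ (2 * r))"
    by (intro sum.cong refl) (auto simp: card_cartesian_product card_PiE power_add mult_2)
  also have "\<dots> = (h choose r) * r ^ (2 * r)" by (simp add: n_subsets)
  finally show ?thesis .
qed

text \<open>In the variable y = x + v the factors with m i = v become y itself, so the zero at x =
  -v moves to 0.\<close>

lemma shift_prod_eq_poly: "shift_prod r x m = poly (\<Prod>i<r. [:m i - v, 1:]) (x + v)"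
  by (simp add: shift_prod_def poly_prod algebra_simps)

lemma degree_shift_poly: "degree (\<Prod>i<r. [:m i - v, 1:] :: int poly) \<le> r"
  using degree_prod_sum_le[of "{..<r}" "\<lambda>i. [:m i - v, 1:]"] by simp

lemma shift_poly_factor:
  "(\<Prod>i<r. [:m i - v, 1:]) = monom 1 (mult_count r m v) * (\<Prod>i\<in>{i \<in> {..<r}. m i \<noteq> v}. [:m i - v, 1:])"
proof -
  have "{..<r} = {i \<in> {..<r}. m i = v} \<union> {i \<in> {..<r}. m i \<noteq> v}" by auto
  then have "(\<Prod>i<r. [:m i - v, 1:]) =
    (\<Prod>i\<in>{i \<in> {..<r}. m i = v} \<union> {i \<in> {..<r}. m i \<noteq> v}. [:m i - v, 1:])"
    by (rule arg_cong)
  also have "\<dots> = (\<Prod>i\<in>{i \<in> {..<r}. m i = v}. [:m i - v, 1:]) * (\<Prod>i\<in>{i \<in> {..<r}. m i \<noteq> v}. [:m i - v, 1:])"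
    by (intro prod.union_disjoint) auto
  also have "(\<Prod>i\<in>{i \<in> {..<r}. m i = v}. [:m i - v, 1:]) = monom 1 (mult_count r m v)"
    by (simp add: mult_count_def monom_altdef)
  finally show ?thesis .
qed

text \<open>The value at 0 is a product of nonzero differences of absolute value below h \<le>
  p.\<close>

lemma shift_poly_cofactor_not_dvd:
  assumes p: "prime p" and hp: "h \<le> p" and m: "m \<in> tuples h r" and v: "v \<in> {1..int h}"
  shows "\<not> int p dvd poly (\<Prod>i\<in>{i \<in> {..<r}. m i \<noteq> v}. [:m i - v, 1:]) 0"
proof
  assume "int p dvd poly (\<Prod>i\<in>{i \<in> {..<r}. m i \<noteq> v}. [:m i - v, 1:]) 0"
  then obtain i where i: "i < r" "m i \<noteq> v" "int p dvd m i - v"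
    using p by (auto simp: poly_prod prime_dvd_prod_iff)
  have "m i \<in> {1..int h}"
    using PiE_mem[of m "{..<r}" "\<lambda>_. {1..int h}" i] m i(1) by (simp add: tuples_def)
  then have "\<bar>m i - v\<bar> < int p" using v hp by auto
  then show False using i by (metis abs_dvd_iff dvd_abs_iff zdvd_not_zless zero_less_abs_iff right_minus_eq)
qed

text \<open>The value v, whose two multiplicities differ modulo l, is moved to 0; the multiplicities
  become the orders a and b of \<open>stepanov_bound_sqrt\<close>.\<close>

lemma card_collision_points_le:
  assumes p: "prime p" and l: "prime l" and ls: "l * s = p - 1" and hp: "h \<le> p"
    and m: "m \<in> tuples h r" "m' \<in> tuples h r"
    and nondeg: "mult_count r m v mod l \<noteq> mult_count r m' v mod l"
    and large: "2 * real r * (real r + 1) + 3 \<le> sqrt p"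
  shows "real (card {x \<in> {0..<int p}. \<not> int p dvd shift_prod r x m * shift_prod r x m' \<and>
      [shift_prod r x m ^ s = shift_prod r x m' ^ s] (mod int p)}) \<le> p / l + (2 * real r + 2) * (sqrt p + 2)"
proof -
  let ?X = "{x \<in> {0..<int p}. \<not> int p dvd shift_prod r x m * shift_prod r x m' \<and>
      [shift_prod r x m ^ s = shift_prod r x m' ^ s] (mod int p)}"
  have v: "v \<in> {1..int h}"
  proof (rule ccontr)
    assume "v \<notin> {1..int h}"
    then have "{i \<in> {..<r}. m i = v} = {}" "{i \<in> {..<r}. m' i = v} = {}"
      using m by (auto simp: tuples_def PiE_iff)
    then show False using nondeg by (simp only: mult_count_def card.empty)
  qed
  have "real (card ((\<lambda>x. x + v) ` ?X)) \<le> p / l + (2 * real r + 2) * (sqrt p + 2)"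
  proof (rule stepanov_bound_sqrt[OF p l ls shift_poly_factor[of m v r]
        shift_poly_cofactor_not_dvd[OF p hp m(1) v] degree_shift_poly shift_poly_factor[of m' v r]
        shift_poly_cofactor_not_dvd[OF p hp m(2) v] degree_shift_poly nondeg _ _ _ _ large])
    show "finite ((\<lambda>x. x + v) ` ?X)"
      by (intro finite_imageI finite_subset[of ?X "{0..<int p}"]) auto
    show "inj_on (\<lambda>x. x mod int p) ((\<lambda>x. x + v) ` ?X)"
    proof (rule inj_onI)
      fix y y' assume y: "y \<in> (\<lambda>x. x + v) ` ?X" "y' \<in> (\<lambda>x. x + v) ` ?X" "y mod int p = y' mod int p"
      then obtain x x' where x: "y = x + v" "y' = x' + v" "x \<in> {0..<int p}" "x' \<in> {0..<int p}" by auto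
      from y(3) x(1,2) have "[x = x'] (mod int p)" by (metis cong_add_rcancel cong_def)
      then show "y = y'" using x by (auto simp: cong_def)
    qed
    fix y assume "y \<in> (\<lambda>x. x + v) ` ?X"
    then obtain x where x: "y = x + v" "x \<in> ?X" by blast
    from x(2) show "\<not> int p dvd poly ((\<Prod>i<r. [:m i - v, 1:]) * (\<Prod>i<r. [:m' i - v, 1:])) y"
      unfolding poly_mult x(1) shift_prod_eq_poly[symmetric] by simp
    from x(2) show "[poly (\<Prod>i<r. [:m i - v, 1:]) y ^ s = poly (\<Prod>i<r. [:m' i - v, 1:]) y ^ s] (mod int p)"
      unfolding x(1) shift_prod_eq_poly[symmetric] by simp
  qed
  then show ?thesis by (simp add: card_image)
qed

section \<open>Upper bound for the number of windows with constant power residue\<close>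

text \<open>When l s = p - 1, the power a^s modulo p acts as a character of order l whose values are
  the l-th roots of unity modulo p.\<close>

definition constant_starts :: "nat \<Rightarrow> nat \<Rightarrow> nat \<Rightarrow> int set" where
  "constant_starts p s h = {x \<in> {0..<int p}. \<forall>m\<in>{1..int h}. \<not> int p dvd x + m \<and>
     [(x + m) ^ s = (x + 1) ^ s] (mod int p)}"

text \<open>The relation \<open>R\<close> between points and pairs of tuples is counted in both
  orders. The main terms p / l cancel and leave card T (1 - 1/l) on the left; since l \<ge> 2,
  removing this factor costs at most a factor 2.\<close>

lemma card_constant_starts_le:
  assumes p: "prime p" and l: "prime l" and ls: "l * s = p - 1" and hp: "h \<le> p"
    and r: "1 \<le> r" "r \<le> h"
    and large: "2 * real r * (real r + 1) + 3 \<le> sqrt p"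
  shows "real (card (constant_starts p s h)) \<le>
    h + 2 * (exp 1 * r / h) ^ r * p + (4 * real r + 4) * (sqrt p + 2)"
proof -
  let ?P = "shift_prod r"
  let ?TT = "tuples h r \<times> tuples h r"
  define R where "R x mm \<longleftrightarrow> \<not> int p dvd ?P x (fst mm) * ?P x (snd mm) \<and>
    [?P x (fst mm) ^ s = ?P x (snd mm) ^ s] (mod int p)" for x mm
  define B where "B = {mm \<in> ?TT. \<forall>v. mult_count r (fst mm) v mod l = mult_count r (snd mm) v mod l}"
  define E where "E = (2 * real r + 2) * (sqrt p + 2)"
  define T where "T = constant_starts p s h"
  define Fr where "Fr = {x \<in> {0..<int p}. \<forall>m\<in>{1..int h}. \<not> int p dvd x + m}"
  define q where "q = real h ^ (2 * r)"
  have p1: "p > 1" using p by (rule prime_gt_1_nat)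
  have l2: "l \<ge> 2" using l by (rule prime_ge_2_nat)
  have h1: "h \<ge> 1" using r by simp
  have q0: "q > 0" using h1 by (simp add: q_def)
  have E0: "E \<ge> 0" by (simp add: E_def)
  have finTT: "finite ?TT" by simp
  have cTT: "real (card ?TT) = q"
    by (simp add: card_cartesian_product card_tuples q_def power_add mult_2)

  have exch: "(\<Sum>x\<in>{0..<int p}. card {mm \<in> ?TT. R x mm}) = (\<Sum>mm\<in>?TT. card {x \<in> {0..<int p}. R x mm})"
    by (rule sum_multicount_gen[symmetric]) auto

  \<comment> \<open>Stepanov's method covers the pairs outside \<open>B\<close>; the degenerate ones
    get the trivial bound p.\<close>
  have up: "real (card {x \<in> {0..<int p}. R x mm}) \<le> (if mm \<in> B then real p else 0) + (p / l + E)"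
    if mm: "mm \<in> ?TT" for mm
  proof (cases "mm \<in> B")
    case True
    have "card {x \<in> {0..<int p}. R x mm} \<le> card {0..<int p}" by (intro card_mono) auto
    then show ?thesis using True E0 by (simp add: add_increasing2)
  next
    case False
    then obtain v where "mult_count r (fst mm) v mod l \<noteq> mult_count r (snd mm) v mod l"
      using mm by (auto simp: B_def)
    from card_collision_points_le[OF p l ls hp _ _ this large] mm show ?thesis
      using False by (auto simp: R_def E_def)
  qed
  have "card B \<le> (h choose r) * r ^ (2 * r)"
  proof -
    have "B = {(m, m') \<in> ?TT. \<forall>v. mult_count r m v mod l = mult_count r m' v mod l}"
      by (auto simp: B_def)
    then show ?thesis using card_degenerate_pairs_le[OF l2 r(2)] by simp
  qed
  then have "real (card B) \<le> real ((h choose r) * r ^ (2 * r))" unfolding of_nat_le_iff .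
  also have "\<dots> \<le> (exp 1 * r * h) ^ r" by (rule binomial_self_power_le)
  finally have cB: "real (card B) \<le> (exp 1 * r * h) ^ r" .

  have "real (\<Sum>mm\<in>?TT. card {x \<in> {0..<int p}. R x mm}) \<le> (\<Sum>mm\<in>?TT. (if mm \<in> B then real p else 0) + (p / l + E))"
    unfolding of_nat_sum by (rule sum_mono[OF up])
  also have "\<dots> = real (card B) * p + q * (p / l + E)"
  proof -
    have "?TT \<inter> B = B" by (auto simp: B_def)
    then show ?thesis using finTT cTT by (simp add: sum.distrib sum.If_cases card_cartesian_product)
  qed
  also have "\<dots> \<le> (exp 1 * r * h) ^ r * p + q * (p / l + E)"
    using cB by (intro add_right_mono mult_right_mono) auto
  finally have upper: "real (\<Sum>mm\<in>?TT. card {x \<in> {0..<int p}. R x mm})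
     \<le> (exp 1 * r * h) ^ r * p + q * (p / l + E)" .

  have nd: "\<not> int p dvd ?P x m" if "x \<in> Fr" "m \<in> tuples h r" for x m
  proof
    assume "int p dvd ?P x m"
    then obtain i where "i < r" "int p dvd x + m i"
      using p by (auto simp: shift_prod_def prime_dvd_prod_iff)
    then show False using that by (auto simp: Fr_def tuples_def)
  qed
  have TF: "T \<subseteq> Fr" by (auto simp: T_def Fr_def constant_starts_def)
  have lowT: "real (card {mm \<in> ?TT. R x mm}) = q" if x: "x \<in> T" for x
  proof -
    have "[?P x m ^ s = ((x + 1) ^ s) ^ r] (mod int p)" if "m \<in> tuples h r" for m
    proof -
      have "[(\<Prod>i<r. (x + m i) ^ s) = (\<Prod>i<r. (x + 1) ^ s)] (mod int p)"
        using x that by (intro cong_prod) (auto simp: T_def constant_starts_def tuples_def)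
      then show ?thesis by (simp add: shift_prod_def prod_power_distrib)
    qed
    then have "[?P x m ^ s = ?P x m' ^ s] (mod int p)" if "m \<in> tuples h r" "m' \<in> tuples h r" for m m'
      using that by (meson cong_sym cong_trans)
    then have "R x mm" if "mm \<in> ?TT" for mm
      using that nd[of x] x TF p unfolding R_def by (auto simp: prime_dvd_mult_iff)
    then have "{mm \<in> ?TT. R x mm} = ?TT" by blast
    then show ?thesis using cTT by simp
  qed
  \<comment> \<open>The s-th powers of nonzero residues are l-th roots of unity, so the tuples fall
    into at most l classes.\<close>
  have lowF: "q / l \<le> real (card {mm \<in> ?TT. R x mm})" if x: "x \<in> Fr" for x
  proof -
    define \<kappa> where "\<kappa> m = ?P x m ^ s mod int p" for m
    have "(real (card (tuples h r)))\<^sup>2 \<le> real (card (\<kappa> ` tuples h r)) *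
        real (card {(m, m') \<in> ?TT. \<kappa> m = \<kappa> m'})"
      by (rule card_collisions_ge) auto
    also have "{(m, m') \<in> ?TT. \<kappa> m = \<kappa> m'} = {mm \<in> ?TT. R x mm}"
      using nd[OF x] p by (auto simp: R_def \<kappa>_def cong_def prime_dvd_mult_iff)
    also have "real (card (\<kappa> ` tuples h r)) \<le> l"
    proof -
      have "[\<kappa> m ^ l = 1] (mod int p)" if "m \<in> tuples h r" for m
      proof -
        have "[\<kappa> m ^ l = (?P x m ^ s) ^ l] (mod int p)" by (intro cong_pow) (simp add: \<kappa>_def cong_def)
        also have "(?P x m ^ s) ^ l = ?P x m ^ (p - 1)" by (metis ls mult.commute power_mult)
        also have "[\<dots> = 1] (mod int p)" using nd[OF x that] by (rule fermat_little_int[OF p])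
        finally show ?thesis .
      qed
      then have "card (\<kappa> ` tuples h r) \<le> l"
        using p1 l2 by (intro card_roots_of_unity_mod_le[OF p]) (auto simp: \<kappa>_def)
      then show ?thesis by simp
    qed
    finally have "q \<le> real l * real (card {mm \<in> ?TT. R x mm})"
      by (simp add: card_tuples q_def power_mult[symmetric] mult.commute mult_right_mono)
    then show ?thesis using l2 by (simp add: field_simps)
  qed
  have finFr: "finite Fr" unfolding Fr_def by (rule finite_subset[of _ "{0..<int p}"]) auto
  \<comment> \<open>A point outside \<open>Fr\<close> is congruent to -m for some m among 1, ...,
    h.\<close>
  have cFr: "real p - real h \<le> card Fr"
  proof -
    have "{0..<int p} \<subseteq> Fr \<union> (\<lambda>m. (- m) mod int p) ` {1..int h}"
    proof
      fix x assume x: "x \<in> {0..<int p}"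
      show "x \<in> Fr \<union> (\<lambda>m. (- m) mod int p) ` {1..int h}"
      proof (cases "x \<in> Fr")
        case False
        then obtain m where m: "m \<in> {1..int h}" "int p dvd x - (- m)" using x by (auto simp: Fr_def)
        then have "x mod int p = (- m) mod int p" by (simp only: mod_eq_dvd_iff)
        then show ?thesis using x m(1) by auto
      qed simp
    qed
    then have "card {0..<int p} \<le> card (Fr \<union> (\<lambda>m. (- m) mod int p) ` {1..int h})"
      using finFr by (intro card_mono) auto
    also have "\<dots> \<le> card Fr + card ((\<lambda>m. (- m) mod int p) ` {1..int h})" by (rule card_Un_le)
    also have "card ((\<lambda>m. (- m) mod int p) ` {1..int h}) \<le> h"
      using card_image_le[of "{1..int h}" "\<lambda>m. (- m) mod int p"] by simp
    finally show ?thesis by simp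
  qed
  have finT: "finite T" using TF finFr by (rule finite_subset)
  have "card T * q + (real p - h - card T) * (q / l) \<le> card T * q + (real (card Fr) - card T) * (q / l)"
    using cFr q0 by (intro add_left_mono mult_right_mono) auto
  also have "\<dots> = (\<Sum>x\<in>T. q) + (\<Sum>x\<in>Fr - T. q / l)"
    using TF finFr finT by (simp add: card_Diff_subset of_nat_diff card_mono)
  also have "\<dots> \<le> (\<Sum>x\<in>T. real (card {mm \<in> ?TT. R x mm})) + (\<Sum>x\<in>Fr - T. real (card {mm \<in> ?TT. R x mm}))"
    using lowT lowF by (intro add_mono sum_mono) auto
  also have "\<dots> = (\<Sum>x\<in>Fr. real (card {mm \<in> ?TT. R x mm}))"
    using sum.subset_diff[OF TF finFr, of "\<lambda>x. real (card {mm \<in> ?TT. R x mm})"] by simp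
  also have "\<dots> \<le> (\<Sum>x\<in>{0..<int p}. real (card {mm \<in> ?TT. R x mm}))"
    by (intro sum_mono2) (auto simp: Fr_def)
  also have "\<dots> = real (\<Sum>mm\<in>?TT. card {x \<in> {0..<int p}. R x mm})"
    unfolding exch[symmetric] by simp
  also note upper
  finally have *: "card T * q + (real p - h - card T) * (q / l) \<le> (exp 1 * r * h) ^ r * p + q * (p / l + E)" .
  \<comment> \<open>After the common weight q = h^(2r) is taken out, the degenerate pairs count as
    the proportion (e r / h)^r.\<close>
  have **: "(exp 1 * r * h) ^ r = (exp 1 * r / h) ^ r * q"
  proof -
    have "exp 1 * real r * real h = exp 1 * real r / real h * (real h)\<^sup>2"
      using h1 by (simp add: power2_eq_square)
    then show ?thesis by (simp only: q_def power_mult power_mult_distrib)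
  qed
  have "q * (card T + (real p - h - card T) / l) \<le> q * ((exp 1 * r / h) ^ r * p + (p / l + E))"
  proof -
    have e: "q * (a + b / l) = a * q + b * (q / l)" "q * (c * p + d) = c * q * p + q * d" for a b c d :: real
      by (simp_all add: algebra_simps)
    show ?thesis using * unfolding ** e .
  qed
  then have "card T + (real p - h - card T) / l \<le> (exp 1 * r / h) ^ r * p + (p / l + E)"
    using q0 by simp
  then have 1: "card T \<le> (exp 1 * r / h) ^ r * p + E + (real h + card T) / l"
    by (simp add: diff_divide_distrib add_divide_distrib)
  have "(real h + card T) / l \<le> (real h + card T) / 2"
    using l2 by (intro divide_left_mono) auto
  then have "card T \<le> (exp 1 * r / h) ^ r * p + E + (real h + card T) / 2"
    using 1 by (rule order.trans[OF _ add_left_mono, rotated])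
  then have "card T \<le> h + 2 * ((exp 1 * r / h) ^ r * p) + 2 * E" by argo
  also have "2 * E = (4 * real r + 4) * (sqrt p + 2)" by (simp add: E_def algebra_simps)
  finally show ?thesis by (simp add: T_def mult.assoc)
qed

section \<open>Dilations of an interval on which the power residue is constant\<close>

text \<open>Telescoping: (2k + 1)^2 exceeds 4 k (k + 1), and 1 / (4 k (k + 1)) = 1 / (4 k) - 1 / (4
  (k + 1)).\<close>

lemma sum_inverse_square_odd_le: "(\<Sum>k=1..n. 1 / real (2 * k + 1) ^ 2) \<le> 1 / 4 - 1 / (4 * (real n + 1))"
proof (induction n)
  case (Suc n)
  have "1 / real (2 * Suc n + 1) ^ 2 \<le> 1 / (4 * (real n + 1)) - 1 / (4 * (real (Suc n) + 1))"
  proof -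
    have "1 / (4 * x) - 1 / (4 * (x + 1)) = 1 / (4 * x * (x + 1))" if "x > 0" for x :: real
      using that by (simp add: divide_simps)
    from this[of "real n + 1"]
    have "1 / (4 * (real n + 1)) - 1 / (4 * (real (Suc n) + 1)) = 1 / (4 * (real n + 1) * (real n + 2))"
      by (simp add: add_ac)
    moreover have "4 * (real n + 1) * (real n + 2) \<le> real (2 * Suc n + 1) ^ 2"
      by (simp add: power2_eq_square algebra_simps)
    ultimately show ?thesis by (simp only:) (intro divide_left_mono; simp)
  qed
  with Suc show ?case by simp
qed simp

lemma sum_inverse_square_primes_le: "(\<Sum>P | prime P \<and> P \<le> X. 1 / real P ^ 2) \<le> 1 / 2"
proof -
  have "{P. prime P \<and> P \<le> X} \<subseteq> insert 2 ((\<lambda>k. 2 * k + 1) ` {1..X})"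
  proof
    fix P assume P: "P \<in> {P. prime P \<and> P \<le> X}"
    show "P \<in> insert 2 ((\<lambda>k. 2 * k + 1) ` {1..X})"
    proof (cases "P = 2")
      case False
      then have "odd P" "P > 2"
        using P prime_ge_2_nat[of P] prime_odd_nat[of P] by auto
      then obtain k where "P = 2 * k + 1" by (auto elim: oddE)
      then show ?thesis using P \<open>P > 2\<close> by auto
    qed simp
  qed
  then have "(\<Sum>P | prime P \<and> P \<le> X. 1 / real P ^ 2) \<le> (\<Sum>P\<in>insert 2 ((\<lambda>k. 2 * k + 1) ` {1..X}). 1 / real P ^ 2)"
    by (intro sum_mono2) auto
  also have "\<dots> = 1 / 4 + (\<Sum>P\<in>(\<lambda>k. 2 * k + 1) ` {1..X}. 1 / real P ^ 2)"
  proof -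
    have "(2::nat) \<notin> (\<lambda>k. 2 * k + 1) ` {1..X}"
    proof
      assume "(2::nat) \<in> (\<lambda>k. 2 * k + 1) ` {1..X}"
      then obtain k :: nat where "2 = 2 * k + 1" by blast
      then show False by presburger
    qed
    then show ?thesis by (simp add: power2_eq_square)
  qed
  also have "(\<Sum>P\<in>(\<lambda>k. 2 * k + 1) ` {1..X}. 1 / real P ^ 2) = (\<Sum>k=1..X. 1 / real (2 * k + 1) ^ 2)"
    by (subst sum.reindex) (auto simp: inj_on_def)
  also have "\<dots> \<le> 1 / 4"
    using sum_inverse_square_odd_le[of X] by (rule order.trans) simp
  finally show ?thesis by simp
qed

text \<open>With K = X div P the sum is at most K X - P K^2 / 2, which falls short of the bound by
  (X - P K)^2 / (2 P).\<close>

lemma sum_multiples_le: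
  assumes "P > 0"
  shows "(\<Sum>q | q \<in> {1..X} \<and> P dvd q. real X - real q) \<le> real X ^ 2 / (2 * real P)"
proof -
  define K where "K = X div P"
  have "{q. q \<in> {1..X} \<and> P dvd q} = (\<lambda>k. P * k) ` {1..K}"
    using assms by (auto simp: K_def less_eq_div_iff_mult_less_eq mult.commute image_iff elim!: dvdE
      intro!: Suc_leI)
  then have "(\<Sum>q | q \<in> {1..X} \<and> P dvd q. real X - real q) = (\<Sum>k=1..K. real X - real P * real k)"
    using assms by (simp add: sum.reindex inj_on_def)
  also have "\<dots> = real K * X - real P * (real K * (real K + 1) / 2)"
  proof (induction K)
    case (Suc n)
    then show ?case by (simp add: field_simps)
  qed simp
  also have "\<dots> \<le> real K * X - real P * real K ^ 2 / 2"
    by (simp add: power2_eq_square field_simps)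
  also have "\<dots> \<le> real X ^ 2 / (2 * real P)"
  proof -
    have "0 \<le> (real X - real P * real K) ^ 2 / (2 * real P)" by simp
    also have "\<dots> = real X ^ 2 / (2 * real P) - (real K * X - real P * real K ^ 2 / 2)"
      using assms by (simp add: power2_eq_square field_simps)
    finally show ?thesis by simp
  qed
  finally show ?thesis .
qed

text \<open>A union bound over the primes P dividing q. The t with P dividing a t + b lie in at most
  one class modulo P: if P divided a, it would divide b as well.\<close>

lemma card_coprime_progression_ge:
  fixes a b :: int and q :: nat
  assumes ab: "coprime a b" and q: "q > 0"
  shows "real q * (1 - (\<Sum>P | prime P \<and> P dvd q. 1 / real P)) \<le> card {t \<in> {0..<int q}. coprime (a * t + b) (int q)}"
proof -
  let ?D = "\<lambda>P. {t \<in> {0..<int q}. int P dvd a * t + b}"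
  let ?C = "{t \<in> {0..<int q}. coprime (a * t + b) (int q)}"
  let ?\<P> = "{P. prime P \<and> P dvd q}"
  have fin: "finite ?\<P>" using q by (intro finite_subset[OF _ finite_divisors_nat[of q]]) auto
  have D: "real (card (?D P)) \<le> real q * (1 / real P)" if P: "P \<in> ?\<P>" for P
  proof -
    obtain k where k: "q = P * k" using P by auto
    have P0: "P > 0" "int P > 0" using P by (auto simp: prime_gt_0_nat)
    have primeP: "prime (int P)" using P by simp
    have "inj_on (\<lambda>t. t div int P) (?D P)"
    proof (rule inj_onI)
      fix t t' assume t: "t \<in> ?D P" "t' \<in> ?D P" and eq: "t div int P = t' div int P"
      have "int P dvd (a * t + b) - (a * t' + b)" using t by (intro dvd_diff) auto
      then have "int P dvd a * (t - t')" by (simp add: algebra_simps)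
      moreover have "\<not> int P dvd a"
      proof
        assume "int P dvd a"
        moreover from this have "int P dvd b" using t(1) by (simp add: dvd_add_right_iff)
        ultimately show False using ab primeP by (meson coprime_common_divisor not_prime_unit)
      qed
      ultimately have "int P dvd t - t'" using primeP by (simp add: prime_dvd_mult_iff)
      then have "t mod int P = t' mod int P" by (simp add: mod_eq_dvd_iff)
      with eq show "t = t'" by (metis div_mult_mod_eq)
    qed
    moreover have "(\<lambda>t. t div int P) ` ?D P \<subseteq> {0..<int k}"
    proof clarify
      fix t assume t: "t \<in> {0..<int q}"
      have "int P * (t div int P) + t mod int P = t" by simp
      then have "int P * (t div int P) \<le> t" using pos_mod_sign[OF P0(2), of t] by linarith
      also have "t < int P * int k" using t k by simp
      finally show "t div int P \<in> {0..<int k}" using t P0 by (simp add: pos_imp_zdiv_nonneg_iff)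
    qed
    ultimately have "card (?D P) \<le> card {0..<int k}" by (intro card_inj_on_le) auto
    then show ?thesis using k P0 by simp
  qed
  have "{0..<int q} \<subseteq> ?C \<union> (\<Union>P\<in>?\<P>. ?D P)"
  proof
    fix t assume t: "t \<in> {0..<int q}"
    show "t \<in> ?C \<union> (\<Union>P\<in>?\<P>. ?D P)"
    proof (cases "coprime (a * t + b) (int q)")
      case False
      then have "gcd (a * t + b) (int q) \<noteq> 0" "\<not> is_unit (gcd (a * t + b) (int q))"
        using q by (auto simp: is_unit_gcd)
      from prime_divisor_exists[OF this] obtain g where g: "prime g" "g dvd a * t + b" "g dvd int q"
        by auto
      then obtain P where P: "g = int P" by (metis nonneg_int_cases prime_ge_0_int)
      then have "P \<in> ?\<P>" using g by simp
      then show ?thesis using g t P by auto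
    qed (use t in auto)
  qed
  then have "card {0..<int q} \<le> card (?C \<union> (\<Union>P\<in>?\<P>. ?D P))"
    by (intro card_mono finite_subset[of "?C \<union> (\<Union>P\<in>?\<P>. ?D P)" "{0..<int q}"]) auto
  also have "\<dots> \<le> card ?C + card (\<Union>P\<in>?\<P>. ?D P)" by (rule card_Un_le)
  also have "\<dots> \<le> card ?C + (\<Sum>P\<in>?\<P>. card (?D P))" using card_UN_le[OF fin] by simp
  finally have "real (card {0..<int q}) \<le> real (card ?C + (\<Sum>P\<in>?\<P>. card (?D P)))"
    unfolding of_nat_le_iff .
  then have "real q \<le> real (card ?C) + (\<Sum>P\<in>?\<P>. real (card (?D P)))" by simp
  also have "(\<Sum>P\<in>?\<P>. real (card (?D P))) \<le> (\<Sum>P\<in>?\<P>. real q * (1 / real P))"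
    by (rule sum_mono[OF D])
  also have "\<dots> = real q * (\<Sum>P\<in>?\<P>. 1 / real P)" by (simp only: sum_distrib_left)
  finally show ?thesis by (simp add: algebra_simps)
qed

text \<open>Up to the factor h, the weight (X - q) / q bounds from below the number of windows in an
  interval of length H / q when h X \<le> H. After exchanging sums, the sieve loses at most X^2 / 2
  times the sum of 1 / P^2, that is X^2 / 4, out of X (X - 1) / 2.\<close>

lemma weighted_coprime_sum_ge:
  fixes a b :: int and X :: nat
  assumes ab: "coprime a b"
  shows "real X * (real X - 2) / 4 \<le>
    (\<Sum>q=1..X. card {t \<in> {0..<int q}. coprime (a * t + b) (int q)} * ((real X - real q) / real q))"
proof -
  let ?\<P> = "{P. prime P \<and> P \<le> X}"
  have P: "{P. prime P \<and> P dvd q} = {P \<in> ?\<P>. P dvd q}" if "q \<in> {1..X}" for q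
    using that by (auto dest: dvd_imp_le)
  have "(\<Sum>q=1..X. (real X - real q) * (\<Sum>P | prime P \<and> P dvd q. 1 / real P))
      = (\<Sum>q=1..X. \<Sum>P\<in>{P \<in> ?\<P>. P dvd q}. (real X - real q) * (1 / real P))"
    by (intro sum.cong refl) (simp only: P sum_distrib_left)
  also have "\<dots> = (\<Sum>P\<in>?\<P>. \<Sum>q | q \<in> {1..X} \<and> P dvd q. (real X - real q) * (1 / real P))"
    by (rule sum.swap_restrict) auto
  also have "\<dots> = (\<Sum>P\<in>?\<P>. (\<Sum>q | q \<in> {1..X} \<and> P dvd q. real X - real q) * (1 / real P))"
    by (simp only: sum_distrib_right)
  also have "\<dots> \<le> (\<Sum>P\<in>?\<P>. real X ^ 2 / (2 * real P) * (1 / real P))"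
    by (intro sum_mono mult_right_mono sum_multiples_le) (auto simp: prime_gt_0_nat)
  also have "\<dots> = (\<Sum>P\<in>?\<P>. real X ^ 2 / 2 * (1 / real P ^ 2))"
    by (intro sum.cong refl) (simp add: power2_eq_square)
  also have "\<dots> = real X ^ 2 / 2 * (\<Sum>P\<in>?\<P>. 1 / real P ^ 2)" by (simp only: sum_distrib_left)
  also have "\<dots> \<le> real X ^ 2 / 2 * (1 / 2)"
    using sum_inverse_square_primes_le[of X] by (intro mult_left_mono) auto
  finally have 1: "(\<Sum>q=1..X. (real X - real q) * (\<Sum>P | prime P \<and> P dvd q. 1 / real P)) \<le> real X ^ 2 / 4"
    by simp
  have "(\<Sum>q=1..n. real X - real q) = real n * X - real n * (real n + 1) / 2" for n
    by (induction n) (simp_all add: field_simps)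
  from this[of X] have 2: "(\<Sum>q=1..X. real X - real q) = real X * (real X - 1) / 2"
    by (simp add: field_simps)
  have "real X * (real X - 2) / 4 \<le> (\<Sum>q=1..X. real X - real q) - (\<Sum>q=1..X. (real X - real q) * (\<Sum>P | prime P \<and> P dvd q. 1 / real P))"
    using 1 unfolding 2 by (simp add: power2_eq_square field_simps)
  also have "\<dots> = (\<Sum>q=1..X. real q * (1 - (\<Sum>P | prime P \<and> P dvd q. 1 / real P)) * ((real X - real q) / real q))"
    unfolding sum_subtractf[symmetric] by (intro sum.cong refl) (simp add: field_simps)
  also have "\<dots> \<le> (\<Sum>q=1..X. card {t \<in> {0..<int q}. coprime (a * t + b) (int q)} * ((real X - real q) / real q))"
    by (intro sum_mono mult_right_mono card_coprime_progression_ge[OF ab]) auto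
  finally show ?thesis .
qed

section \<open>Disjoint dilated intervals modulo p\<close>

text \<open>Division of the interval shifted by p t by q leaves at least H div q consecutive
  integers after \<open>(N + p * t) div q\<close>; i is the offset of a window of h of them.\<close>

lemma fraction_interval:
  fixes N p t q i m h H :: int
  assumes "q > 0" "0 \<le> i" "i \<le> H div q - h" "1 \<le> m" "m \<le> h"
  shows "q * ((N + p * t) div q + i + m) - p * t \<in> {N<..N + H}"
proof -
  define d where "d = (N + p * t) div q"
  have d: "q * d \<le> N + p * t" "N + p * t < q * d + q"
    using assms(1) unfolding d_def
    by (metis mult.commute pos_mod_sign le_add_same_cancel1 mult_div_mod_eq, metis add_strict_left_mono mult_div_mod_eq pos_mod_bound)
  have "q * 1 \<le> q * (i + m)" using assms by (intro mult_left_mono) auto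
  moreover have "q * (i + m) \<le> q * (H div q)" using assms by (intro mult_left_mono) auto
  moreover have "q * (H div q) \<le> H" using assms(1) by (metis mult_div_mod_eq pos_mod_sign le_add_same_cancel1)
  ultimately show ?thesis using d unfolding d_def[symmetric] by (auto simp: algebra_simps)
qed

text \<open>Multiplying by \<open>a\<close> replaces \<open>N\<close> by \<open>p b\<close> up to a small error, so that the two memberships determine
  a multiple of \<open>p\<close> of absolute value less than \<open>p\<close>.\<close>

lemma fraction_intervals_disjoint:
  fixes a b p N H X q q' t t' y y' :: int
  assumes a: "0 < a" "a \<le> 2 * X" and approx: "\<bar>a * N - p * b\<bar> * (2 * X) < p"
    and H: "4 * H * X ^ 2 \<le> p" and X: "X \<ge> 1"
    and q: "0 < q" "q \<le> X" "0 < q'" "q' \<le> X"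
    and cop: "coprime (a * t + b) q" "coprime (a * t' + b) q'"
    and t: "0 \<le> t" "t < q" "0 \<le> t'" "t' < q'"
    and u: "q * y - p * t \<in> {N<..N + H}" "q' * y' - p * t' \<in> {N<..N + H}"
    and y: "p dvd y' - y"
  shows "q = q' \<and> t = t' \<and> y = y'"
proof -
  obtain k where k: "y' = y + p * k" using y by (metis add.commute diff_add_cancel dvdE)
  define \<eta> where "\<eta> = a * N - p * b"
  define \<epsilon> where "\<epsilon> = q * y - p * t - N"
  define \<epsilon>' where "\<epsilon>' = q' * y' - p * t' - N"
  define Z where "Z = a * (q * t' - q' * t - q * q' * k) - b * (q' - q)"
  have \<epsilon>: "0 < \<epsilon>" "\<epsilon> \<le> H" "0 < \<epsilon>'" "\<epsilon>' \<le> H" using u by (auto simp: \<epsilon>_def \<epsilon>'_def)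
  \<comment> \<open>Both summands are at most p / 2 in absolute value, the first strictly less,
    hence Z = 0.\<close>
  have id: "p * Z = \<eta> * (q' - q) + a * (q' * \<epsilon> - q * \<epsilon>')"
    unfolding Z_def \<eta>_def \<epsilon>_def \<epsilon>'_def k by (simp add: algebra_simps)
  have p0: "p > 0" using approx by (smt (verit) X mult_nonneg_nonneg)
  have "\<bar>\<eta> * (q' - q)\<bar> \<le> \<bar>\<eta>\<bar> * X" using q by (simp add: abs_mult mult_left_mono)
  then have 1: "2 * \<bar>\<eta> * (q' - q)\<bar> < p" using approx by (simp add: \<eta>_def)
  have "0 \<le> q' * \<epsilon>" "0 \<le> q * \<epsilon>'" "q' * \<epsilon> \<le> X * H" "q * \<epsilon>' \<le> X * H"
    using q \<epsilon> by (auto intro!: mult_mono)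
  then have "\<bar>q' * \<epsilon> - q * \<epsilon>'\<bar> \<le> X * H" by linarith
  then have "\<bar>a * (q' * \<epsilon> - q * \<epsilon>')\<bar> \<le> (2 * X) * (X * H)"
    unfolding abs_mult using a by (intro mult_mono) auto
  then have 2: "2 * \<bar>a * (q' * \<epsilon> - q * \<epsilon>')\<bar> \<le> p" using H by (simp add: power2_eq_square mult_ac)
  have "\<bar>p * Z\<bar> < p * 1" unfolding id using 1 2 by linarith
  then have "Z = 0" using p0 by (simp add: abs_mult)
  \<comment> \<open>Z = 0 says that (a t + b) / q and (a t' + b) / q' differ by a k. Both fractions
    are in lowest terms, so the denominators agree.\<close>
  then have e: "q * (a * t' + b - a * q' * k) = q' * (a * t + b)" by (simp add: Z_def algebra_simps)
  have "q dvd q' * (a * t + b)" unfolding e[symmetric] by simp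
  then have "q dvd q'" using cop(1) by (simp add: coprime_dvd_mult_left_iff coprime_commute)
  have "coprime (a * t' + b - a * q' * k) q'"
  proof -
    have "a * t' + b - a * q' * k = (- a * k) * q' + (a * t' + b)" by (simp add: algebra_simps)
    then show ?thesis using cop(2) by (metis coprime_commute coprime_iff_gcd_eq_1 gcd_add_mult)
  qed
  moreover have "q' dvd q * (a * t' + b - a * q' * k)" unfolding e by simp
  ultimately have "q' dvd q" by (simp add: coprime_dvd_mult_left_iff coprime_commute)
  with \<open>q dvd q'\<close> q have qq: "q = q'" by (simp add: zdvd_antisym_nonneg)
  with e q have "a * t' + b - a * q * k = a * t + b" by simp
  then have "a * (t' - t - q * k) = 0" by (simp add: algebra_simps)
  then have tk: "t' - t = q * k" using a by simp
  have "\<bar>t' - t\<bar> < q" using t qq by auto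
  then have "k = 0" unfolding tk using q by (simp add: abs_mult)
  then show ?thesis using qq tk k by simp
qed

text \<open>Division by q modulo p sends the interval to q shorter ones indexed by t, and the s-th
  power stays constant on each because q^s cancels. Coprimality of a t + b and q selects intervals
  that are disjoint modulo p, and the sieve shows that enough of them remain.\<close>

lemma card_constant_starts_ge:
  fixes p s h X H :: nat and N :: int
  assumes p: "prime p" and h: "1 \<le> h" and X: "1 \<le> X" and hX: "h * X \<le> H" and HX: "4 * H * X ^ 2 \<le> p"
    and nz: "\<And>z. z \<in> {N<..N + int H} \<Longrightarrow> \<not> int p dvd z"
    and const: "\<And>z z'. z \<in> {N<..N + int H} \<Longrightarrow> z' \<in> {N<..N + int H} \<Longrightarrow> [z ^ s = z' ^ s] (mod int p)"
  shows "real h * (real X * (real X - 2) / 4) \<le> card (constant_starts p s h)"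
proof -
  have p0: "p > 0" using p by (rule prime_gt_0_nat)
  \<comment> \<open>Dirichlet approximation of N / p at level 2 X gives both the range of a and the
    small error that \<open>fraction_intervals_disjoint\<close> requires.\<close>
  obtain b a where ab: "coprime b a" "0 < a" "a \<le> int (2 * X)"
    "\<bar>of_int a * (of_int N / real p) - of_int b\<bar> < 1 / real (2 * X)"
    using Dirichlet_approx_coprime[of "2 * X" "of_int N / real p"] X by auto
  have "real_of_int (\<bar>a * N - int p * b\<bar> * (2 * int X)) =
      \<bar>of_int a * (of_int N / real p) - of_int b\<bar> * real p * real (2 * X)"
    using p0 by (simp add: field_simps abs_mult flip: abs_mult_pos')
  also have "\<dots> < 1 / real (2 * X) * real p * real (2 * X)"
    using ab(4) p0 X by (intro mult_strict_right_mono) auto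
  also have "\<dots> = real_of_int (int p)" using X by simp
  finally have approx: "\<bar>a * N - int p * b\<bar> * (2 * int X) < int p" by (simp only: of_int_less_iff)
  let ?T = "\<lambda>q. {t \<in> {0..<int q}. coprime (a * t + b) (int q)}"
  define Idx where "Idx = Sigma {1..X} (\<lambda>q. ?T q \<times> {0..int H div int q - int h})"
  define z where "z = (\<lambda>(q, t, i). (N + int p * t) div int q + i)"
  have u: "int q * (z (q, t, i) + m) - int p * t \<in> {N<..N + int H}"
    if "(q, t, i) \<in> Idx" "m \<in> {1..int h}" for q t i m
    using that fraction_interval[of "int q" i "int H" "int h" m N "int p" t] by (auto simp: Idx_def z_def)
  have fin: "finite (constant_starts p s h)"
    unfolding constant_starts_def by (rule finite_subset[of _ "{0..<int p}"]) auto
  have finT: "finite (?T q)" for q by (rule finite_subset[of _ "{0..<int q}"]) auto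
  have "(\<lambda>j. z j mod int p) ` Idx \<subseteq> constant_starts p s h"
  proof clarify
    fix q t i assume j: "(q, t, i) \<in> Idx"
    define w where "w = z (q, t, i)"
    have m: "\<not> int p dvd w mod int p + m \<and> [int q ^ s * (w mod int p + m) ^ s = (int q * (w + m) - int p * t) ^ s] (mod int p)
        \<and> \<not> int p dvd int q"
      if "m \<in> {1..int h}" for m
    proof -
      have 1: "[int q * (w mod int p + m) = int q * (w + m) - int p * t] (mod int p)"
      proof -
        have "[int q * (w mod int p + m) - 0 = int q * (w + m) - int p * t] (mod int p)"
          by (intro cong_diff cong_mult cong_add cong_refl) (simp_all add: cong_def)
        then show ?thesis by simp
      qed
      have "\<not> int p dvd int q * (w + m) - int p * t" using nz[OF u[OF j that]] by (simp add: w_def)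
      then have "\<not> int p dvd int q * (w mod int p + m)" using 1 by (simp add: cong_dvd_iff)
      moreover have "[int q ^ s * (w mod int p + m) ^ s = (int q * (w + m) - int p * t) ^ s] (mod int p)"
        using cong_pow[OF 1, of s] by (simp add: power_mult_distrib)
      ultimately show ?thesis by auto
    qed
    have one: "1 \<in> {1..int h}" using h by simp
    have "[(w mod int p + m) ^ s = (w mod int p + 1) ^ s] (mod int p)" if mh: "m \<in> {1..int h}" for m
    proof -
      have "[int q ^ s * (w mod int p + m) ^ s = (int q * (w + m) - int p * t) ^ s] (mod int p)"
        using m[OF mh] by simp
      also have "[(int q * (w + m) - int p * t) ^ s = (int q * (w + 1) - int p * t) ^ s] (mod int p)"
        unfolding w_def by (rule const[OF u[OF j mh] u[OF j one]])
      also have "[(int q * (w + 1) - int p * t) ^ s = int q ^ s * (w mod int p + 1) ^ s] (mod int p)"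
        using m[OF one] by (simp add: cong_sym_eq)
      finally have "[int q ^ s * (w mod int p + m) ^ s = int q ^ s * (w mod int p + 1) ^ s] (mod int p)" .
      moreover have "coprime (int q ^ s) (int p)"
        using m[OF one] p by (metis coprime_commute coprime_power_left_iff prime_imp_coprime prime_nat_int_transfer)
      ultimately show ?thesis by (simp add: cong_mult_lcancel)
    qed
    then show "z (q, t, i) mod int p \<in> constant_starts p s h"
      using m p0 unfolding constant_starts_def w_def by auto
  qed
  moreover have "inj_on (\<lambda>j. z j mod int p) Idx"
  proof (rule inj_onI)
    fix j j' assume jj: "j \<in> Idx" "j' \<in> Idx" and eq: "z j mod int p = z j' mod int p"
    obtain q t i q' t' i' where j: "j = (q, t, i)" "j' = (q', t', i')" by (cases j, cases j')
    have one: "1 \<in> {1..int h}" using h by simp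
    \<comment> \<open>The first element z + 1 of each window determines q and t; then z gives
      i.\<close>
    have "int q = int q' \<and> t = t' \<and> z j + 1 = z j' + 1"
    proof (rule fraction_intervals_disjoint)
      show "0 < a" "a \<le> 2 * int X" "\<bar>a * N - int p * b\<bar> * (2 * int X) < int p" using ab approx by auto
      show "4 * int H * int X ^ 2 \<le> int p"
        using HX by (metis (mono_tags) of_nat_le_iff of_nat_mult of_nat_numeral of_nat_power)
      show "int q * (z j + 1) - int p * t \<in> {N<..N + int H}" "int q' * (z j' + 1) - int p * t' \<in> {N<..N + int H}"
        using u jj one unfolding j by blast+
      show "int p dvd z j' + 1 - (z j + 1)" using eq by (metis add_diff_cancel_right mod_eq_dvd_iff)
    qed (use jj X in \<open>auto simp: Idx_def j\<close>)
    then show "j = j'" by (auto simp: j z_def)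
  qed
  ultimately have "card Idx \<le> card (constant_starts p s h)" using fin by (metis card_inj_on_le)
  moreover have "real h * (real X * (real X - 2) / 4) \<le> card Idx"
  proof -
    have "real h * (real X * (real X - 2) / 4) \<le> real h * (\<Sum>q=1..X. card (?T q) * ((real X - real q) / real q))"
      using ab(1) by (intro mult_left_mono weighted_coprime_sum_ge) (auto simp: coprime_commute)
    also have "\<dots> = (\<Sum>q=1..X. card (?T q) * (real h * ((real X - real q) / real q)))"
      by (simp add: sum_distrib_left mult_ac)
    also have "\<dots> \<le> (\<Sum>q=1..X. card (?T q) * real (card {0..int H div int q - int h}))"
    proof (intro sum_mono mult_left_mono)
      fix q assume q: "q \<in> {1..X}"
      have "real h * ((real X - real q) / real q) = real (h * X) / real q - real h"
        using q by (simp add: field_simps)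
      also have "\<dots> \<le> real H / real q - real h"
        using hX q by (intro diff_right_mono divide_right_mono) (auto simp flip: of_nat_mult)
      \<comment> \<open>The 1 lost by rounding down is regained because the range of offsets
        includes both 0 and \<open>int H div int q - int h\<close>.\<close>
      also have "real H / real q \<le> real_of_int (int H div int q) + 1"
        using real_of_int_div2[of "int H" "int q"] real_of_int_div3[of "int H" "int q"] by simp
      finally show "real h * ((real X - real q) / real q) \<le> real (card {0..int H div int q - int h})"
        by simp
    qed simp
    also have "\<dots> = real (card Idx)"
      unfolding Idx_def using finT by (subst card_SigmaI) (auto simp: card_cartesian_product)
    finally show ?thesis .
  qed
  ultimately show ?thesis by linarith
qed

section \<open>Dirichlet characters\<close>

text \<open>The value \<omega> of X at a primitive root g is not 1, and l is a prime factor of its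
  order. If X agrees at g^i and g^j, then l divides i - j, and (g^l)^s = g^(p-1) is 1 modulo
  p.\<close>

lemma nonprincipal_character_power_residue:
  assumes p: "prime p" and X: "dirichlet_character p X" "X \<noteq> principal_character p"
  obtains l s where "prime l" "l * s = p - 1"
    "\<And>a b. \<not> int p dvd a \<Longrightarrow> \<not> int p dvd b \<Longrightarrow> X a = X b \<Longrightarrow> [a ^ s = b ^ s] (mod int p)"
proof -
  have mult: "X (a * b) = X a * X b" and per: "X (a + int p) = X a"
    and zero: "X a = 0 \<longleftrightarrow> \<not> coprime a (int p)" for a b
    using X(1) by (auto simp: dirichlet_character_def)
  have p1: "p > 1" using p by (rule prime_gt_1_nat)
  have X1: "X 1 = 1" using mult[of 1 1] zero[of 1] by simp
  have pow: "X (a ^ n) = X a ^ n" for a n by (induction n) (simp_all add: X1 mult)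
  have per_nat: "X (a + int p * int n) = X a" for a n
  proof (induction n)
    case (Suc n)
    then show ?case using per[of "a + int p * int n"] by (simp add: algebra_simps)
  qed simp
  have congX: "X a = X b" if "[a = b] (mod int p)" for a b
  proof -
    have "\<exists>n. a = b + int p * int n \<or> b = a + int p * int n"
    proof -
      obtain k where k: "b = a + int p * k" using \<open>[a = b] (mod int p)\<close> by (auto simp: cong_iff_lin)
      show ?thesis
      proof (cases "k \<ge> 0")
        case True
        then have "b = a + int p * int (nat k)" using k by simp
        then show ?thesis by blast
      next
        case False
        then have "a = b + int p * int (nat (-k))" using k by simp
        then show ?thesis by blast
      qed
    qed
    then show ?thesis using per_nat by metis
  qed
  have cop: "coprime a (int p) \<longleftrightarrow> \<not> int p dvd a" for a
    using p by (metis coprime_commute prime_imp_coprime prime_nat_int_transfer coprime_absorb_left not_prime_unit)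
  obtain g where g: "residue_primroot p g" using prime_primitive_root_exists[of p] p p1 by blast
  have gen: "\<exists>i. [a = int g ^ i] (mod int p)" if a: "\<not> int p dvd a" for a
  proof -
    have "nat (a mod int p) \<in> totatives p"
    proof -
      have "0 < a mod int p" using a p1
        by (metis dvd_eq_mod_eq_0 le_less of_nat_0_less_iff order_less_trans pos_mod_sign zero_less_one)
      moreover have "a mod int p < int p" using p1 by simp
      ultimately show ?thesis using p p1 by (auto simp: totatives_prime nat_less_iff)
    qed
    then obtain i where "nat (a mod int p) = g ^ i mod p"
      using residue_primroot_is_generator[OF p1 g] by (auto simp: bij_betw_def)
    then have "a mod int p = int g ^ i mod int p"
      using p1 by (metis nat_0_le of_nat_0_less_iff of_nat_mod of_nat_power order_less_trans pos_mod_sign zero_less_one)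
    then show ?thesis by (auto simp: cong_def)
  qed
  define \<omega> where "\<omega> = X (int g)"
  have Xi: "X a = \<omega> ^ i" if "[a = int g ^ i] (mod int p)" for a i
    using congX[OF that] pow by (simp add: \<omega>_def)
  have gp: "\<not> int p dvd int g"
    using g p by (metis coprime_absorb_left int_dvd_int_iff not_prime_unit residue_primroot_def)
  have fermat: "[int g ^ (p - 1) = 1] (mod int p)" by (rule fermat_little_int[OF p gp])
  have \<omega>p: "\<omega> ^ (p - 1) = 1" using congX[OF fermat] pow X1 by (simp add: \<omega>_def)
  have \<omega>1: "\<omega> \<noteq> 1"
  proof
    assume "\<omega> = 1"
    have "X a = principal_character p a" for a
    proof (cases "int p dvd a")
      case True
      then show ?thesis using zero[of a] cop[of a] by (simp add: principal_character_def)
    next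
      case False
      then show ?thesis using gen[OF False] Xi \<open>\<omega> = 1\<close> cop[of a] by (auto simp: principal_character_def)
    qed
    then show False using X(2) by auto
  qed
  define n where "n = (LEAST n. n > 0 \<and> \<omega> ^ n = 1)"
  have n: "n > 0" "\<omega> ^ n = 1"
    using LeastI[of "\<lambda>n. n > 0 \<and> \<omega> ^ n = 1" "p - 1"] p1 \<omega>p by (auto simp: n_def)
  have n_dvd: "n dvd k" if "\<omega> ^ k = 1" for k
  proof (rule ccontr)
    assume "\<not> n dvd k"
    then have "k mod n > 0" by (simp add: mod_greater_zero_iff_not_dvd)
    moreover have "\<omega> ^ (k mod n) = 1"
    proof -
      have "\<omega> ^ k = (\<omega> ^ n) ^ (k div n) * \<omega> ^ (k mod n)" by (metis div_mult_mod_eq mult.commute power_add power_mult)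
      then show ?thesis using that n(2) by simp
    qed
    ultimately have "n \<le> k mod n" unfolding n_def by (intro Least_le) simp
    then show False using n(1) by (meson linorder_not_le mod_less_divisor)
  qed
  have "n \<noteq> 1" using n \<omega>1 by auto
  then obtain l where l: "prime l" "l dvd n" using prime_factor_nat by blast
  then have "l dvd p - 1" using n_dvd[OF \<omega>p] by (meson dvd_trans)
  then obtain s where s: "l * s = p - 1" by (metis dvdE)
  have step: "[a ^ s = b ^ s] (mod int p)"
    if ij: "[a = int g ^ i] (mod int p)" "[b = int g ^ j] (mod int p)" "i \<le> j" "X a = X b" for a b i j
  proof -
    have "\<omega> \<noteq> 0" using \<omega>p p1 by (auto simp: power_0_left split: if_splits)
    have "\<omega> ^ i * \<omega> ^ (j - i) = \<omega> ^ i * 1" using ij Xi by (metis le_add_diff_inverse mult.right_neutral power_add)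
    then have "\<omega> ^ (j - i) = 1" using \<open>\<omega> \<noteq> 0\<close> by simp
    then have "l dvd j - i" using n_dvd l(2) by (meson dvd_trans)
    then obtain k where k: "j = i + l * k" using ij(3) by (metis dvdE le_add_diff_inverse)
    have "[b ^ s = (int g ^ j) ^ s] (mod int p)" using ij(2) by (rule cong_pow)
    also have "(int g ^ j) ^ s = (int g ^ i) ^ s * (int g ^ (p - 1)) ^ k"
      unfolding s[symmetric] k by (simp add: power_add power_mult_distrib mult_ac flip: power_mult)
    also have "[(int g ^ i) ^ s * (int g ^ (p - 1)) ^ k = a ^ s * 1 ^ k] (mod int p)"
      using ij(1) fermat by (intro cong_mult cong_pow) (auto simp: cong_sym_eq)
    finally show ?thesis by (simp add: cong_sym_eq)
  qed
  show ?thesis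
  proof (rule that[OF l(1) s])
    fix a b assume "\<not> int p dvd a" "\<not> int p dvd b" and eq: "X a = X b"
    then obtain i j where "[a = int g ^ i] (mod int p)" "[b = int g ^ j] (mod int p)" using gen by meson
    then show "[a ^ s = b ^ s] (mod int p)"
      using step[of a i b j] step[of b j a i] eq by (cases "i \<le> j") (auto simp: cong_sym_eq)
  qed
qed

text \<open>A multiple of p would carry the value 0 to a neighbour, which exists in the interval as
  H \<ge> 2; but consecutive integers are not both divisible by p.\<close>

lemma character_constant_imp_not_dvd:
  assumes p: "prime p" and X: "dirichlet_character p X" and const: "X constant_on {N<..N + H}"
    and H: "H \<ge> 2" and z: "z \<in> {N<..N + H}"
  shows "\<not> int p dvd z"
proof
  assume dvd: "int p dvd z"
  have zero: "X a = 0 \<longleftrightarrow> int p dvd a" for a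
  proof -
    have "X a = 0 \<longleftrightarrow> \<not> coprime a (int p)" using X by (simp add: dirichlet_character_def)
    also have "\<dots> \<longleftrightarrow> int p dvd a"
      using p by (metis coprime_absorb_left coprime_commute not_prime_unit prime_imp_coprime prime_nat_int_transfer)
    finally show ?thesis .
  qed
  define w where "w = (if z = N + 1 then z + 1 else z - 1)"
  have "w \<in> {N<..N + H}" using z H by (auto simp: w_def)
  then have "X w = X z" using const z by (auto simp: constant_on_def)
  then have "int p dvd w" using zero dvd by metis
  then have "int p dvd w - z" using dvd by (rule dvd_diff)
  then have "int p dvd 1" by (auto simp: w_def split: if_splits)
  then show False using p by (simp add: prime_gt_1_nat)
qed

text \<open>An interval of length at least p contains a multiple of p. This bound serves the
  finitely many primes outside the asymptotic range.\<close>

lemma character_constant_length_less: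
  assumes p: "prime p" and X: "dirichlet_character p X" and const: "X constant_on {N<..N + H}"
  shows "H < int p"
proof (rule ccontr)
  assume "\<not> H < int p"
  moreover have "p \<ge> 2" using p by (rule prime_ge_2_nat)
  ultimately have H: "H \<ge> 2" "H \<ge> int p" by auto
  have p0: "int p > 0" using \<open>p \<ge> 2\<close> by simp
  let ?z = "int p * (N div int p + 1)"
  have "int p * (N div int p) + N mod int p = N" by simp
  then have "N < ?z" "?z \<le> N + H"
    using H pos_mod_bound[OF p0, of N] pos_mod_sign[OF p0, of N] unfolding distrib_left by linarith+
  then have "?z \<in> {N<..N + H}" by simp
  from character_constant_imp_not_dvd[OF p X const H(1) this] show False by simp
qed

section \<open>Numerical choices and the final estimate\<close>

text \<open>Since e^3 \<le> 21, the ratio is at most e^(-2), and r \<ge> (ln p) / 4 makes its r-th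
  power at most p^(-1/2).\<close>

lemma power_exp_ratio_le:
  assumes r: "ln (real p) / 4 \<le> real r" "r > 0" and p: "p > 0"
  shows "(exp 1 * real r / real (21 * r)) ^ r * real p \<le> sqrt p"
proof -
  have "exp (3::real) = exp 1 ^ 3" by (simp add: exp_of_nat_mult[of 3 "1::real", simplified])
  also have "\<dots> \<le> (272 / 100) ^ 3" using e_less_272 by (intro power_mono) auto
  also have "\<dots> \<le> (21::real)" by (simp add: power3_eq_cube)
  finally have "exp (3::real) \<le> 21" .
  moreover have "exp (1::real) = exp 3 * exp (- 2)" by (simp flip: exp_add)
  ultimately have "exp (1::real) \<le> 21 * exp (- 2)" by simp
  then have "exp 1 * real r / real (21 * r) \<le> exp (- 2)" using r(2) by (simp add: field_simps)
  then have "(exp 1 * real r / real (21 * r)) ^ r \<le> exp (- 2) ^ r" by (intro power_mono) auto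
  also have "\<dots> = exp (real r * (- 2))" by (rule exp_of_nat_mult[symmetric])
  also have "\<dots> \<le> exp (- (ln (real p) / 2))" using r(1) by simp
  also have "\<dots> = 1 / sqrt p" using p by (simp add: exp_minus ln_sqrt[symmetric] inverse_eq_divide)
  finally have "(exp 1 * real r / real (21 * r)) ^ r * real p \<le> 1 / sqrt p * real p" by (intro mult_right_mono) auto
  also have "\<dots> = sqrt p" using p by (simp add: real_div_sqrt)
  finally show ?thesis .
qed

text \<open>With r near L / 4, h = 21 r and Y near Q, a segment of length h Y, about (21/4) Q L,
  fits below 6 Q L. Dilation yields about (21/4) r \<open>sqrt p\<close> constant starts, while the
  collision count allows only about 4 r \<open>sqrt p\<close>.\<close>

lemma character_constant_length_bound:
  fixes X :: "int \<Rightarrow> complex" and N H :: int and p :: nat and L Q :: real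
  defines "L \<equiv> ln (real p)" and "Q \<equiv> real p powr (1 / 4)"
  assumes p: "prime p" and X: "dirichlet_character p X" "X \<noteq> principal_character p"
    and const: "X constant_on {N<..N + H}"
    and big: "L \<ge> 4" "Q \<ge> 2" "2 * (L / 4 + 1) * (L / 4 + 2) + 3 \<le> sqrt p" "21 * (L / 4 + 1) \<le> p"
      "21 * (L / 4 + 1) * (Q + 1) \<le> 6 * Q * L" "4 * (21 * (L / 4 + 1) * (Q + 1)) * (Q + 1) ^ 2 \<le> p"
      "0 \<le> 21 * Q * (Q - 2) / 4 - 29 - 4 * sqrt p"
      "L / 4 * (21 * Q * (Q - 2) / 4 - 29 - 4 * sqrt p) > 6 * sqrt p + 8"
  shows "H < 6 * Q * L"
proof (rule ccontr)
  assume "\<not> H < 6 * Q * L"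
  then have HQ: "6 * Q * L \<le> H" by simp
  define r where "r = nat \<lceil>L / 4\<rceil>"
  define Y where "Y = nat \<lceil>Q\<rceil>"
  have "real r = \<lceil>L / 4\<rceil>" "real Y = \<lceil>Q\<rceil>" using big(1,2) by (auto simp: r_def Y_def)
  then have r: "L / 4 \<le> r" "r \<le> L / 4 + 1" and Y: "Q \<le> Y" "Y \<le> Q + 1" by linarith+
  have r1: "r \<ge> 1" using r big(1) by linarith
  have Y1: "Y \<ge> 1" using Y big(2) by linarith
  have p0: "p > 0" using p by (rule prime_gt_0_nat)
  define h where "h = 21 * r"
  have hr: "real h \<le> 21 * (L / 4 + 1)" using r by (simp add: h_def)
  have hY: "real (h * Y) \<le> 21 * (L / 4 + 1) * (Q + 1)"
    using hr Y unfolding of_nat_mult by (intro mult_mono) (use big in auto)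
  then have "real (h * Y) \<le> real_of_int H" using big(5) HQ by linarith
  \<comment> \<open>Only the first h Y elements of the interval are kept, since disjointness of the
    dilated intervals limits the length from above.\<close>
  then have hYH: "int (h * Y) \<le> H" by linarith
  obtain l s where ls: "prime l" "l * s = p - 1"
    "\<And>a b. \<not> int p dvd a \<Longrightarrow> \<not> int p dvd b \<Longrightarrow> X a = X b \<Longrightarrow> [a ^ s = b ^ s] (mod int p)"
    by (rule nonprincipal_character_power_residue[OF p X]) blast
  have "21 * 1 \<le> h * Y" using r1 Y1 unfolding h_def by (intro mult_mono) auto
  then have H2: "H \<ge> 2" using hYH by linarith
  have nz: "\<not> int p dvd z" if "z \<in> {N<..N + int (h * Y)}" for z
    using character_constant_imp_not_dvd[OF p X(1) const H2] that hYH by auto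
  have eqX: "X z = X z'" if "z \<in> {N<..N + int (h * Y)}" "z' \<in> {N<..N + int (h * Y)}" for z z'
    using const that hYH by (auto simp: constant_on_def)
  have "real (4 * (h * Y) * Y ^ 2) = 4 * real (h * Y) * real Y ^ 2" by simp
  also have "\<dots> \<le> 4 * (21 * (L / 4 + 1) * (Q + 1)) * (Q + 1) ^ 2"
    by (rule mult_mono[OF mult_left_mono[OF hY] power_mono[OF Y(2)]]) (use big in auto)
  also have "\<dots> \<le> p" by (rule big(6))
  finally have size: "4 * (h * Y) * Y ^ 2 \<le> p" unfolding of_nat_le_iff .
  have cong: "[z ^ s = z' ^ s] (mod int p)" if "z \<in> {N<..N + int (h * Y)}" "z' \<in> {N<..N + int (h * Y)}" for z z'
    using ls(3) nz eqX that by blast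
  have h1: "1 \<le> h" using r1 by (simp add: h_def)
  have lower: "real h * (real Y * (real Y - 2) / 4) \<le> card (constant_starts p s h)"
    by (rule card_constant_starts_ge[OF p h1 Y1 order_refl size nz cong])
  have "real h \<le> p" using hr big(4) by linarith
  then have hp: "h \<le> p" by simp
  have "2 * real r * (real r + 1) + 3 \<le> 2 * (L / 4 + 1) * (L / 4 + 2) + 3"
    using r by (intro add_right_mono mult_mono) auto
  also note big(3)
  finally have "real (card (constant_starts p s h)) \<le>
      h + 2 * (exp 1 * r / h) ^ r * p + (4 * real r + 4) * (sqrt p + 2)"
    using r1 by (intro card_constant_starts_le[OF p ls(1,2) hp]) (auto simp: h_def)
  also have "2 * (exp 1 * r / h) ^ r * p \<le> 2 * sqrt p"
    using power_exp_ratio_le[of p r] r(1) r1 p0 by (simp add: h_def L_def)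
  finally have upper: "real (card (constant_starts p s h)) \<le> 21 * r + 2 * sqrt p + (4 * real r + 4) * (sqrt p + 2)"
    by (simp add: h_def)
  have "Q * (Q - 2) \<le> real Y * (real Y - 2)" using Y big(2) by (intro mult_mono) auto
  then have "real h * (Q * (Q - 2) / 4) \<le> real h * (real Y * (real Y - 2) / 4)"
    by (intro mult_left_mono divide_right_mono) auto
  with lower upper have "real h * (Q * (Q - 2) / 4) \<le> 21 * r + 2 * sqrt p + (4 * real r + 4) * (sqrt p + 2)"
    by linarith
  then have "r * (21 * Q * (Q - 2) / 4 - 29 - 4 * sqrt p) \<le> 6 * sqrt p + 8"
    by (simp add: h_def algebra_simps)
  moreover have "L / 4 * (21 * Q * (Q - 2) / 4 - 29 - 4 * sqrt p) \<le> r * (21 * Q * (Q - 2) / 4 - 29 - 4 * sqrt p)"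
    using r(1) big(7) by (rule mult_right_mono)
  ultimately show False using big(8) by linarith
qed

text \<open>The delicate conditions are the fifth, where 21/4 < 6 compares coefficients of x^(1/4)
  ln x, and the last two, where 21/4 > 4 leaves a positive multiple of \<open>sqrt x\<close>,
  multiplied by ln x in the last.\<close>

lemma eventually_size_conditions:
  "eventually (\<lambda>x::real. ln x \<ge> 4 \<and> x powr (1 / 4) \<ge> 2 \<and>
    2 * (ln x / 4 + 1) * (ln x / 4 + 2) + 3 \<le> sqrt x \<and> 21 * (ln x / 4 + 1) \<le> x \<and>
    21 * (ln x / 4 + 1) * (x powr (1 / 4) + 1) \<le> 6 * x powr (1 / 4) * ln x \<and>
    4 * (21 * (ln x / 4 + 1) * (x powr (1 / 4) + 1)) * (x powr (1 / 4) + 1) ^ 2 \<le> x \<and>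
    0 \<le> 21 * x powr (1 / 4) * (x powr (1 / 4) - 2) / 4 - 29 - 4 * sqrt x \<and>
    ln x / 4 * (21 * x powr (1 / 4) * (x powr (1 / 4) - 2) / 4 - 29 - 4 * sqrt x) > 6 * sqrt x + 8) at_top"
  by (intro eventually_conj; real_asymp)

text \<open>The bounds 5/2 for e and 12/5 for \<open>sqrt 6\<close> multiply to exactly 6, and
  \<open>pi\<close> / 3 > 1.\<close>

lemma leading_constant_ge: "6 \<le> pi * exp 1 * sqrt 6 / 3"
proof -
  have "5 / 2 \<le> exp (1::real)" using exp_lower_Taylor_quadratic[of 1] by simp
  moreover have "12 / 5 \<le> sqrt 6" by (rule real_le_rsqrt) (simp add: power2_eq_square)
  ultimately have "5 / 2 * (12 / 5) \<le> exp 1 * sqrt 6" by (intro mult_mono) auto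
  then have "3 * 6 \<le> pi * (exp 1 * sqrt 6)" using pi_gt3 by (intro mult_mono) auto
  then show ?thesis by simp
qed

theorem theorem1p1:
  shows "\<exists>\<epsilon> :: nat \<Rightarrow> real.
    (\<epsilon> \<longlongrightarrow> 0) (inf at_top (principal {p. prime p})) \<and>
    (\<forall>(p::nat) (X :: int \<Rightarrow> complex) (N::int) (H::int).
       prime p \<longrightarrow> dirichlet_character p X \<longrightarrow> X \<noteq> principal_character p \<longrightarrow>
       H \<ge> 1 \<longrightarrow> X constant_on {N<..N + H} \<longrightarrow>
       real_of_int H < (pi * exp 1 * sqrt 6 / 3 + \<epsilon> p) * real p powr (1/4) * ln (real p))"
proof -
  have "eventually (\<lambda>p::nat. \<forall>X N H. prime p \<longrightarrow> dirichlet_character p X \<longrightarrow> X \<noteq> principal_character p \<longrightarrow>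
      X constant_on {N<..N + H} \<longrightarrow> real_of_int H < 6 * real p powr (1 / 4) * ln (real p)) at_top"
    using eventually_compose_filterlim[OF eventually_size_conditions filterlim_real_sequentially]
    by eventually_elim (blast intro: character_constant_length_bound)
  then obtain p0 where p0: "real_of_int H < 6 * real p powr (1 / 4) * ln (real p)"
    if "p \<ge> p0" "prime p" "dirichlet_character p X" "X \<noteq> principal_character p" "X constant_on {N<..N + H}"
    for p X N H
    unfolding eventually_at_top_linorder by blast
  \<comment> \<open>From \<open>p0\<close> on, the constant 6 suffices with no error term. For
    smaller p the value 2 p is enough, because H < p, p^(1/4) \<ge> 1 and ln p \<ge> 1/2.\<close>
  define \<epsilon> where "\<epsilon> p = (if p < p0 then 2 * real p else 0)" for p
  have "eventually (\<lambda>p. \<epsilon> p = 0) at_top"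
    using eventually_ge_at_top[of p0] by eventually_elim (simp add: \<epsilon>_def)
  then have "(\<epsilon> \<longlongrightarrow> 0) (inf at_top (principal {p. prime p}))"
    by (rule tendsto_mono[OF inf_le1 tendsto_eventually])
  moreover have "real_of_int H < (pi * exp 1 * sqrt 6 / 3 + \<epsilon> p) * real p powr (1/4) * ln (real p)"
    if p: "prime p" and X: "dirichlet_character p X" "X \<noteq> principal_character p" "X constant_on {N<..N + H}"
    for p X N H
  proof -
    have p2: "p \<ge> 2" using p by (rule prime_ge_2_nat)
    then have "ln 2 \<le> ln (real p)" by simp
    then have ln: "1 / 2 \<le> ln (real p)" using ln2_ge_two_thirds by linarith
    show ?thesis
    proof (cases "p < p0")
      case True
      have "real_of_int H < real p" using character_constant_length_less[OF p X(1,3)] by linarith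
      also have "real p = (2 * real p) * 1 * (1 / 2)" by simp
      also have "\<dots> \<le> (pi * exp 1 * sqrt 6 / 3 + \<epsilon> p) * real p powr (1/4) * ln (real p)"
        using True p2 ln leading_constant_ge by (intro mult_mono ge_one_powr_ge_zero) (auto simp: \<epsilon>_def)
      finally show ?thesis .
    next
      case False
      then have "real_of_int H < 6 * real p powr (1 / 4) * ln (real p)" using p0 p X by simp
      also have "\<dots> \<le> (pi * exp 1 * sqrt 6 / 3 + \<epsilon> p) * real p powr (1/4) * ln (real p)"
        using False ln leading_constant_ge by (intro mult_right_mono) (auto simp: \<epsilon>_def)
      finally show ?thesis .
    qed
  qed
  ultimately show ?thesis by blast
qed

end
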